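(* Let $G=(V,D,B)$ be a directed mixed graph (possibly cyclic), let $W\subseteq V$ be HTC-identified with witness sets $(Y_u)_{u\in W}$ and HTC ordering $\prec$, and let $X^{(1)},X^{(2)},\dots$ be i.i.d. from $P_0=P_{(\beta,\varepsilon)}\in\mathcal{M}_G$, at which $A_u$ is invertible for every $u\in W$. Then for every $v\in W$ the HTC estimator $\hat\beta_{v,n}$ satisfies $$\sqrt n(\hat\beta_{v,n}-\beta_v)\xrightarrow{d}\mathcal{N}(0,\mathcal{V}_v),\qquad \mathcal{V}_v=A_v^{-1}\,\mathrm{E}[R_vR_v^\top]\,A_v^{-\top}.$$ For the edge $p_j\to v$, the asymptotic variance is $\mathcal{V}_v[j,j]=e_j^\top\mathcal{V}_ve_j$. Moreover, for $a,b\in Y_v$ the entries of $\mathrm{E}[R_vR_v^\top]$ are given by: (i) if $a,b\notin\mathrm{htr}(v)$: $\ \mathrm{E}[R_{a,v}R_{b,v}]=\mathrm{E}[X_aX_b\varepsilon_v^2]$; (ii) if $a\in\mathrm{htr}(v)$, $b\notin\mathrm{htr}(v)$: $$\mathrm{E}[R_{a,v}R_{b,v}]=\mathrm{E}[\varepsilon_aX_b\varepsilon_v^2]-\sum_{q\in\mathrm{pa}(a)}\mathrm{E}[X_q\varepsilon_v]\,\mathrm{E}[\phi_{\beta_{qa}}X_b\varepsilon_v];$$ (iii) if $a,b\in\mathrm{htr}(v)$: $$\begin{aligned}\mathrm{E}[R_{a,v}R_{b,v}]={}&\mathrm{E}[\varepsilon_a\varepsilon_b\varepsilon_v^2]-\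sum_{r\in\mathrm{pa}(b)}\mathrm{E}[X_r\varepsilon_v]\,\mathrm{E}[\varepsilon_a\varepsilon_v\phi_{\beta_{rb}}]-\sum_{q\in\mathrm{pa}(a)}\mathrm{E}[X_q\varepsilon_v]\,\mathrm{E}[\phi_{\beta_{qa}}\varepsilon_b\varepsilon_v]\\&+\sum_{q\in\mathrm{pa}(a)}\sum_{r\in\mathrm{pa}(b)}\mathrm{E}[X_q\varepsilon_v]\,\mathrm{E}[X_r\varepsilon_v]\,\mathrm{E}[\phi_{\beta_{qa}}\phi_{\beta_{rb}}].\end{aligned}$$
   Context: Graphs. A directed mixed graph $G=(V,D,B)$ has a finite vertex set $V$, directed edges $D\subseteq V^2$ (written $v\to w$) and bidirected edges $B\subseteq\binom V2$ (written $v\leftrightarrow w$), with no self-loops; directed cycles are allowed. $\mathrm{pa}(v)=\{w:w\to v\in D\}$, $\mathrm{sib}(v)=\{w:w\leftrightarrow v\in B\}$, and for $U\subseteq V$, $\mathrm{sib}(U)=\{v\in V\setminus U: v\leftrightarrow w\in B\text{ for some }w\in U\}$. A half-trek is a path $\pi$ of the form $v_0\to v_1\to\cdots\to v_\ell$ or $v_0\leftrightarrow v_1\to\cdots\to v_\ell$, with $\mathrm{Left}(\pi)=\{v_0\}$, $\mathrm{Right}(\pi)=\{v_1,\dots,v_\ell\}$. $\mathrm{htr}(v)$ is the set of $w\in V\setminus(\{v\}\cup\mathrm{sib}(v))$ such that there is a half-trek from $v$ to $w$. A system of half-treks has no sided intersection if $\mathrm{Left}(\pi_i)\cap\mathrm{Left}(\pi_j)=\emptyset=\mathrm{Right}(\pi_i)\cap\mathrm{Right}(\pi_j)$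 for all $i\ne j$. Half-trek criterion (HTC). $Y\subset V$ satisfies the HTC for $v$ if (i) $|Y|=|\mathrm{pa}(v)|$; (ii) $Y\cap(\{v\}\cup\mathrm{sib}(v))=\emptyset$; (iii) there is a system of half-treks from $Y$ to $\mathrm{pa}(v)$ with no sided intersection. $W\subseteq V$ is HTC-identified with witness sets $(Y_u)_{u\in W}$ and HTC ordering $\prec$ (a total order on $W$) if $Y_u$ satisfies the HTC for $u$ for each $u\in W$, and $w\prec u$ (in particular $w\in W$) whenever $w\in Y_u\cap\mathrm{htr}(u)$. Model. $\mathcal{B}$ is the set of $\beta\in\mathbb{R}^{|V|\times|V|}$ with $\beta_{wv}=0$ whenever $w\to v\notin D$ and $\det(I-\beta)\neq0$. $\mathcal{E}$ is the set of mean-zero $\mathbb{R}^{|V|}$-valued random vectors $\varepsilon$ with finite fourth moment such that $\varepsilon_U$ is independent of $\varepsilon_{V\setminus(U\cup\mathrm{sib}(U))}$ for every $U\subseteq V$ connected in $(V,B)$. $P_{(\beta,\varepsilon)}$ is the distribution of $X=(I-\beta)^{-\top}\varepsilon$, the solution of $X=\beta^\top X+\varepsilon$, and $\mathcal{M}_G=\{P_{(\beta,\varepsilon)}:\beta\in\mathcal{B},\varepsilon\in\mathcal{E}\}$. Expectations $\mathrm{E}$ are under $P_0$; $\varepsilon_v=X_v-\beta_v^\top X_{\mathrm{pa}(v)}$ is regarded as a function of $X$; $\beta_v=(\beta_{p_1v},\dots,\beta_{p_kv})^\top$ for $\mathrm{pa}(v)=\{p_1,\dots,p_k\}$. Instruments.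 For $v\in W$ and $y\in Y_v$: $Z_y=\varepsilon_y=X_y-\beta_y^\top X_{\mathrm{pa}(y)}$ if $y\in\mathrm{htr}(v)$ and $Z_y=X_y$ if $y\notin\mathrm{htr}(v)$. $A_v=\mathrm{E}[Z_{Y_v}X_{\mathrm{pa}(v)}^\top]$. Row contributions, defined recursively along $\prec$ together with $\phi_{\beta_u}=A_u^{-1}R_u$ for $u\in W$ (its entry for the edge $q\to u$ is denoted $\phi_{\beta_{qu}}$): $R_v=(R_{y,v})_{y\in Y_v}$ with $$R_{y,v}=\begin{cases}X_y\varepsilon_v,& y\notin\mathrm{htr}(v),\\ \varepsilon_y\varepsilon_v-\sum_{q\in\mathrm{pa}(y)}\mathrm{E}[X_q\varepsilon_v]\,\phi_{\beta_{qy}},& y\in\mathrm{htr}(v).\end{cases}$$ HTC estimator. Recursively along $\prec$, $\hat\beta_{v,n}=\hat A_v^{-1}\hat b_v$ with $\hat A_v=\frac1n\sum_{i=1}^n\hat Z_{Y_v}^{(i)}(X^{(i)}_{\mathrm{pa}(v)})^\top$ and $\hat b_v=\frac1n\sum_{i=1}^n\hat Z_{Y_v}^{(i)}X_v^{(i)}$, where for $y\in Y_v$, $\hat Z_y^{(i)}=X_y^{(i)}-\hat\beta_{y,n}^\top X^{(i)}_{\mathrm{pa}(y)}$ if $y\in\mathrm{htr}(v)$ and $\hat Z^{(i)}_y=X^{(i)}_y$ otherwise (defined arbitrarily if some $\hat A_u$ needed is singular). Equivalently $\hat\beta_{v,n}$ solves $\frac1n\sum_i\hat Z^{(i)}_{Y_v}(X_v^{(i)}-\hat\beta_{v,n}^\top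 X_{\mathrm{pa}(v)}^{(i)})=0$. *)

theory Defs
  imports "HOL-Probability.Probability"
begin

(* The vertex set is a finite type 'v. An edge v -> w is the pair (v, w) in D, an edge v <-> w is
   the two-element set {v, w} in B. *)

definition mixed_graph :: "('v::finite \<times> 'v) set \<Rightarrow> 'v set set \<Rightarrow> bool" where
  "mixed_graph D B \<longleftrightarrow> irrefl D \<and> (\<forall>e\<in>B. card e = 2)"

definition pa :: "('v::finite \<times> 'v) set \<Rightarrow> 'v \<Rightarrow> 'v set" where
  "pa D v = {w. (w, v) \<in> D}"

definition sib :: "'v::finite set set \<Rightarrow> 'v \<Rightarrow> 'v set" where
  "sib B v = {w. {w, v} \<in> B}"

definition sib_set :: "'v::finite set set \<Rightarrow> 'v set \<Rightarrow> 'v set" where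
  "sib_set B U = {v. v \<notin> U \<and> (\<exists>w\<in>U. {v, w} \<in> B)}"

(* Connectedness of the subgraph of (V, B) induced on U. *)
definition bidir_connected :: "'v::finite set set \<Rightarrow> 'v set \<Rightarrow> bool" where
  "bidir_connected B U \<longleftrightarrow>
     (\<forall>u\<in>U. \<forall>w\<in>U. (u, w) \<in> {(a, b). a \<in> U \<and> b \<in> U \<and> {a, b} \<in> B}\<^sup>*)"


(* Half_Trek False v0 [v1, ..., vl] is v0 -> v1 -> ... -> vl (l = 0 allowed);
   Half_Trek True v0 [v1, ..., vl] is v0 <-> v1 -> ... -> vl (l >= 1).
   As usual for treks, vertices may be repeated. *)
datatype 'v half_trek = Half_Trek (bidir: bool) (source: 'v) (rest: "'v list")

fun is_half_trek :: "('v::finite \<times> 'v) set \<Rightarrow> 'v set set \<Rightarrow> 'v half_trek \<Rightarrow> bool" where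
  "is_half_trek D B (Half_Trek False v vs) \<longleftrightarrow> successively (\<lambda>a b. (a, b) \<in> D) (v # vs)"
| "is_half_trek D B (Half_Trek True v vs) \<longleftrightarrow>
     vs \<noteq> [] \<and> {v, hd vs} \<in> B \<and> successively (\<lambda>a b. (a, b) \<in> D) vs"

definition target :: "'v half_trek \<Rightarrow> 'v" where
  "target \<pi> = last (source \<pi> # rest \<pi>)"

definition Left :: "'v half_trek \<Rightarrow> 'v set" where
  "Left \<pi> = {source \<pi>}"

definition Right :: "'v half_trek \<Rightarrow> 'v set" where
  "Right \<pi> = set (rest \<pi>)"

definition htr :: "('v::finite \<times> 'v) set \<Rightarrow> 'v set set \<Rightarrow> 'v \<Rightarrow> 'v set" where
  "htr D B v = {w. w \<notin> {v} \<union> sib B v \<and>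
                   (\<exists>\<pi>. is_half_trek D B \<pi> \<and> source \<pi> = v \<and> target \<pi> = w)}"

definition half_trek_system ::
  "('v::finite \<times> 'v) set \<Rightarrow> 'v set set \<Rightarrow> 'v set \<Rightarrow> 'v set \<Rightarrow> 'v half_trek set \<Rightarrow> bool" where
  "half_trek_system D B Y P T \<longleftrightarrow>
     (\<forall>\<pi>\<in>T. is_half_trek D B \<pi>) \<and> bij_betw source T Y \<and> bij_betw target T P"

definition no_sided_intersection :: "'v half_trek set \<Rightarrow> bool" where
  "no_sided_intersection T \<longleftrightarrow>
     (\<forall>\<pi>\<in>T. \<forall>\<rho>\<in>T. \<pi> \<noteq> \<rho> \<longrightarrow> Left \<pi> \<inter> Left \<rho> = {} \<and> Right \<pi> \<inter> Right \<rho> = {})"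

definition satisfies_htc ::
  "('v::finite \<times> 'v) set \<Rightarrow> 'v set set \<Rightarrow> 'v \<Rightarrow> 'v set \<Rightarrow> bool" where
  "satisfies_htc D B v Y \<longleftrightarrow>
     card Y = card (pa D v) \<and>
     Y \<inter> ({v} \<union> sib B v) = {} \<and>
     (\<exists>T. half_trek_system D B Y (pa D v) T \<and> no_sided_intersection T)"

definition htc_identified ::
  "('v::finite \<times> 'v) set \<Rightarrow> 'v set set \<Rightarrow> 'v set \<Rightarrow> ('v \<Rightarrow> 'v set) \<Rightarrow> ('v \<times> 'v) set \<Rightarrow> bool" where
  "htc_identified D B W Y prec \<longleftrightarrow>
     prec \<subseteq> W \<times> W \<and> strict_linear_order_on W prec \<and>
     (\<forall>u\<in>W. satisfies_htc D B u (Y u)) \<and>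
     (\<forall>u\<in>W. \<forall>w \<in> Y u \<inter> htr D B u. (w, u) \<in> prec)"


(* The entry beta_{wv} is beta $ w $ v. *)
definition coefficient_matrices :: "('v::finite \<times> 'v) set \<Rightarrow> (real^'v^'v) set" where
  "coefficient_matrices D =
     {\<beta>. (\<forall>w v. (w, v) \<notin> D \<longrightarrow> \<beta> $ w $ v = 0) \<and> det (mat 1 - \<beta>) \<noteq> 0}"

definition error_vector ::
  "'v::finite set set \<Rightarrow> 'b measure \<Rightarrow> ('b \<Rightarrow> real^'v) \<Rightarrow> bool" where
  "error_vector B \<Omega> \<epsilon> \<longleftrightarrow>
     prob_space \<Omega> \<and> \<epsilon> \<in> borel_measurable \<Omega> \<and>
     (\<forall>v. integrable \<Omega> (\<lambda>\<omega>. (\<epsilon> \<omega> $ v) ^ 4)) \<and>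
     (\<forall>v. (\<integral>\<omega>. \<epsilon> \<omega> $ v \<partial>\<Omega>) = 0) \<and>
     (\<forall>U. bidir_connected B U \<longrightarrow>
        prob_space.indep_var \<Omega>
          (\<Pi>\<^sub>M u\<in>U. borel) (\<lambda>\<omega>. \<lambda>u\<in>U. \<epsilon> \<omega> $ u)
          (\<Pi>\<^sub>M u\<in>-(U \<union> sib_set B U). borel) (\<lambda>\<omega>. \<lambda>u\<in>-(U \<union> sib_set B U). \<epsilon> \<omega> $ u))"

definition model_dist ::
  "real^'v^'v \<Rightarrow> 'b measure \<Rightarrow> ('b \<Rightarrow> real^'v) \<Rightarrow> (real^'v::finite) measure" where
  "model_dist \<beta> \<Omega> \<epsilon> = distr \<Omega> borel (\<lambda>\<omega>. transpose (matrix_inv (mat 1 - \<beta>)) *v \<epsilon> \<omega>)"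


(* A matrix with rows indexed by the finite set I and columns indexed by the finite set J is a
   function of two arguments, of which only the values on I x J matter. The inverse, whose rows are
   indexed by J and columns by I, is chosen as in matrix_inv; it is unique on J x I. *)
definition inverse_on ::
  "'i set \<Rightarrow> 'j set \<Rightarrow> ('i \<Rightarrow> 'j \<Rightarrow> real) \<Rightarrow> ('j \<Rightarrow> 'i \<Rightarrow> real) \<Rightarrow> bool" where
  "inverse_on I J A C \<longleftrightarrow>
     (\<forall>i\<in>I. \<forall>i'\<in>I. (\<Sum>j\<in>J. A i j * C j i') = (if i = i' then 1 else 0)) \<and>
     (\<forall>j\<in>J. \<forall>j'\<in>J. (\<Sum>i\<in>I. C j i * A i j') = (if j = j' then 1 else 0))"

definition invertible_on :: "'i set \<Rightarrow> 'j set \<Rightarrow> ('i \<Rightarrow> 'j \<Rightarrow> real) \<Rightarrow> bool" where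
  "invertible_on I J A \<longleftrightarrow> (\<exists>C. inverse_on I J A C)"

definition inv_on :: "'i set \<Rightarrow> 'j set \<Rightarrow> ('i \<Rightarrow> 'j \<Rightarrow> real) \<Rightarrow> 'j \<Rightarrow> 'i \<Rightarrow> real" where
  "inv_on I J A = (SOME C. inverse_on I J A C)"


(* For b = beta this is epsilon_v as a function of X. *)
definition residual :: "('v::finite \<times> 'v) set \<Rightarrow> real^'v^'v \<Rightarrow> 'v \<Rightarrow> real^'v \<Rightarrow> real" where
  "residual D b v x = x $ v - (\<Sum>q\<in>pa D v. b $ q $ v * x $ q)"

(* The instrument for y in Y_v: Z_y for b = beta, and its sample version for b = beta-hat. *)
definition instrument ::
  "('v::finite \<times> 'v) set \<Rightarrow> 'v set set \<Rightarrow> real^'v^'v \<Rightarrow> 'v \<Rightarrow> 'v \<Rightarrow> real^'v \<Rightarrow> real" where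
  "instrument D B b v y x = (if y \<in> htr D B v then residual D b y x else x $ y)"

definition A_matrix ::
  "('v::finite \<times> 'v) set \<Rightarrow> 'v set set \<Rightarrow> real^'v^'v \<Rightarrow> (real^'v) measure \<Rightarrow> 'v \<Rightarrow> 'v \<Rightarrow> 'v \<Rightarrow> real" where
  "A_matrix D B \<beta> P v y p = (\<integral>x. instrument D B \<beta> v y x * x $ p \<partial>P)"

definition R_step ::
  "('v::finite \<times> 'v) set \<Rightarrow> 'v set set \<Rightarrow> real^'v^'v \<Rightarrow> (real^'v) measure \<Rightarrow>
   ('v \<Rightarrow> 'v \<Rightarrow> real^'v \<Rightarrow> real) \<Rightarrow> 'v \<Rightarrow> 'v \<Rightarrow> real^'v \<Rightarrow> real" where
  "R_step D B \<beta> P \<phi> v y x =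
     (if y \<in> htr D B v
      then residual D \<beta> y x * residual D \<beta> v x
           - (\<Sum>q\<in>pa D y. (\<integral>z. z $ q * residual D \<beta> v z \<partial>P) * \<phi> y q x)
      else x $ y * residual D \<beta> v x)"

(* phi D B Y prec beta P u q is phi_{beta_{qu}}, by well-founded recursion along prec; see the
   recursion equations phi_eq and R_eq below. *)
definition phi ::
  "('v::finite \<times> 'v) set \<Rightarrow> 'v set set \<Rightarrow> ('v \<Rightarrow> 'v set) \<Rightarrow> ('v \<times> 'v) set \<Rightarrow>
   real^'v^'v \<Rightarrow> (real^'v) measure \<Rightarrow> 'v \<Rightarrow> 'v \<Rightarrow> real^'v \<Rightarrow> real" where
  "phi D B Y prec \<beta> P =
     wfrec prec (\<lambda>\<phi> u q x.
       \<Sum>y\<in>Y u. inv_on (Y u) (pa D u) (A_matrix D B \<beta> P u) q y * R_step D B \<beta> P \<phi> u y x)"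

definition R_contribution ::
  "('v::finite \<times> 'v) set \<Rightarrow> 'v set set \<Rightarrow> ('v \<Rightarrow> 'v set) \<Rightarrow> ('v \<times> 'v) set \<Rightarrow>
   real^'v^'v \<Rightarrow> (real^'v) measure \<Rightarrow> 'v \<Rightarrow> 'v \<Rightarrow> real^'v \<Rightarrow> real" where
  "R_contribution D B Y prec \<beta> P v y x = R_step D B \<beta> P (phi D B Y prec \<beta> P) v y x"

lemma R_eq:
  "R_contribution D B Y prec \<beta> P v y x =
     (if y \<in> htr D B v
      then residual D \<beta> y x * residual D \<beta> v x
           - (\<Sum>q\<in>pa D y. (\<integral>z. z $ q * residual D \<beta> v z \<partial>P) * phi D B Y prec \<beta> P y q x)
      else x $ y * residual D \<beta> v x)"
  by (simp add: R_contribution_def R_step_def)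

lemma phi_eq:
  assumes "htc_identified D B W Y prec" and "u \<in> W"
  shows "phi D B Y prec \<beta> P u q x =
     (\<Sum>y\<in>Y u. inv_on (Y u) (pa D u) (A_matrix D B \<beta> P u) q y
                 * R_contribution D B Y prec \<beta> P u y x)"
proof -
  have ord: "trans prec" "irrefl prec" and step: "\<forall>w \<in> Y u \<inter> htr D B u. (w, u) \<in> prec"
    using assms by (auto simp: htc_identified_def strict_linear_order_on_def)
  have "acyclic prec"
    using ord by (simp add: acyclic_irrefl)
  then have "wf prec"
    by (simp add: finite_acyclic_wf)
  let ?\<phi> = "phi D B Y prec \<beta> P"
  have "R_step D B \<beta> P (cut ?\<phi> prec u) u y x = R_step D B \<beta> P ?\<phi> u y x" if "y \<in> Y u" for y
    using that step by (auto simp: R_step_def cut_apply)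
  then show ?thesis
    using fun_cong[OF fun_cong[OF def_wfrec[OF phi_def[THEN eq_reflection] \<open>wf prec\<close>]]]
    by (simp add: R_contribution_def)
qed

definition asymptotic_covariance ::
  "('v::finite \<times> 'v) set \<Rightarrow> 'v set set \<Rightarrow> ('v \<Rightarrow> 'v set) \<Rightarrow> ('v \<times> 'v) set \<Rightarrow>
   real^'v^'v \<Rightarrow> (real^'v) measure \<Rightarrow> 'v \<Rightarrow> 'v \<Rightarrow> 'v \<Rightarrow> real" where
  "asymptotic_covariance D B Y prec \<beta> P v p q =
     (let C = inv_on (Y v) (pa D v) (A_matrix D B \<beta> P v);
          R = R_contribution D B Y prec \<beta> P v
      in \<Sum>a\<in>Y v. \<Sum>b\<in>Y v. C p a * (\<integral>x. R a x * R b x \<partial>P) * C q b)"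


(* The sample of size n is x 0, ..., x (n - 1). *)
definition A_hat ::
  "('v::finite \<times> 'v) set \<Rightarrow> 'v set set \<Rightarrow> nat \<Rightarrow> (nat \<Rightarrow> real^'v) \<Rightarrow> real^'v^'v \<Rightarrow>
   'v \<Rightarrow> 'v \<Rightarrow> 'v \<Rightarrow> real" where
  "A_hat D B n x b v y p = 1 / real n * (\<Sum>i<n. instrument D B b v y (x i) * x i $ p)"

definition b_hat ::
  "('v::finite \<times> 'v) set \<Rightarrow> 'v set set \<Rightarrow> nat \<Rightarrow> (nat \<Rightarrow> real^'v) \<Rightarrow> real^'v^'v \<Rightarrow>
   'v \<Rightarrow> 'v \<Rightarrow> real" where
  "b_hat D B n x b v y = 1 / real n * (\<Sum>i<n. instrument D B b v y (x i) * x i $ v)"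

(* The estimates for v and all u on which the recursion for v depends. *)
definition needed ::
  "('v::finite \<times> 'v) set \<Rightarrow> 'v set set \<Rightarrow> ('v \<Rightarrow> 'v set) \<Rightarrow> 'v \<Rightarrow> 'v set" where
  "needed D B Y v = {u. (u, v) \<in> {(w, u). w \<in> Y u \<inter> htr D B u}\<^sup>*}"

(* b $ p $ v for p in pa(v), v in W are the HTC estimates computed from the sample. They are left
   arbitrary if a needed A_hat is singular; the other entries of b are irrelevant. *)
definition is_htc_estimate ::
  "('v::finite \<times> 'v) set \<Rightarrow> 'v set set \<Rightarrow> 'v set \<Rightarrow> ('v \<Rightarrow> 'v set) \<Rightarrow>
   nat \<Rightarrow> (nat \<Rightarrow> real^'v) \<Rightarrow> real^'v^'v \<Rightarrow> bool" where
  "is_htc_estimate D B W Y n x b \<longleftrightarrow>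
     (\<forall>v\<in>W. (\<forall>u\<in>needed D B Y v. invertible_on (Y u) (pa D u) (A_hat D B n x b u)) \<longrightarrow>
        (\<forall>p\<in>pa D v. b $ p $ v =
           (\<Sum>y\<in>Y v. inv_on (Y v) (pa D v) (A_hat D B n x b v) p y * b_hat D B n x b v y)))"


(* N is the centred normal distribution on R^I with covariance matrix S (possibly singular): the
   law of L z with S = L L^T and z standard normal on R^I. *)
definition multivariate_normal ::
  "'i set \<Rightarrow> ('i \<Rightarrow> 'i \<Rightarrow> real) \<Rightarrow> ('i \<Rightarrow> real) measure \<Rightarrow> bool" where
  "multivariate_normal I S N \<longleftrightarrow>
     (\<exists>L :: 'i \<Rightarrow> 'i \<Rightarrow> real.
        (\<forall>i\<in>I. \<forall>j\<in>I. S i j = (\<Sum>k\<in>I. L i k * L j k)) \<and>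
        N = distr (\<Pi>\<^sub>M k\<in>I. std_normal_distribution) (\<Pi>\<^sub>M i\<in>I. borel)
              (\<lambda>z. \<lambda>i\<in>I. \<Sum>k\<in>I. L i k * z k))"

(* Weak convergence of probability measures on R^I, I finite; elements of R^I are the functions in
   the extensional product of copies of the reals over I. *)
definition weak_conv_on ::
  "'i set \<Rightarrow> (nat \<Rightarrow> ('i \<Rightarrow> real) measure) \<Rightarrow> ('i \<Rightarrow> real) measure \<Rightarrow> bool" where
  "weak_conv_on I \<mu> N \<longleftrightarrow>
     (\<forall>f. continuous_map (powertop_real I) euclideanreal f \<and>
          bounded (f ` topspace (powertop_real I)) \<longrightarrow>
        (\<lambda>n. \<integral>z. f z \<partial>\<mu> n) \<longlonglongrightarrow> (\<integral>z. f z \<partial>N))"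

end

(* The moment conditions E[Z_y eps_v] = 0 hold because a nonzero correlation of X_y and eps_v needs a
   directed path to y from v or from a sibling of v, that is, a half-trek. They turn the normal equations
   of the estimator into a linear system A_hat (sqrt n (beta_hat - beta)) = G, where G is up to o_P(1) the
   normalized sum of R_v; the errors of the preceding estimates cause the correction term in R_v.
   Induction along the HTC ordering gives
   sqrt n (beta_hat_v - beta_v) = n^(-1/2) sum_i phi_v(X_i) + o_P(1), and the central limit theorem applies
   to every linear combination of the entries. The Cramer-Wold device then yields the joint limit: on a
   large box a bounded continuous function of x is a continuous function of the numbers sin(c x_j), hence
   uniformly close to a trigonometric polynomial. *)

theory Submission
  imports Defs
begin

text \<open>For \<open>y\<close> in \<open>htr v\<close> the instrument is the error at
  \<open>y\<close> itself; the HTC keeps \<open>y\<close> away from \<open>v\<close> and its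
  siblings, so the errors at \<open>y\<close> and \<open>v\<close> are independent. Fourth moments
  suffice because, along the recursion, every \<open>R\<close> and \<open>\<phi>\<close> stays
  bounded by a multiple of the squared norm, so that a product of two of them is integrable. The
  estimator is arbitrary where a needed \<open>A_hat\<close> is singular, and inverses are chosen by
  \<open>SOME\<close>. Convergence in probability is therefore phrased through measurable
  exceptional sets of vanishing probability, not through the probability of the bad event itself:
  intermediate quantities then need no measurability proof, and singularity of \<open>A_hat\<close>
  is absorbed into one more exceptional set. The limit covariance may be singular. Hence the central
  limit theorem has to cover variance zero, and the normal law is built from a factor
  \<open>L\<close> of the covariance instead of a density. The joint limit lives on extensional
  functions over \<open>pa D v\<close>, a set depending on \<open>v\<close>; padding with zeros
  moves it to a Euclidean space.\<close>

subsection \<open>Convergence in probability as a filter\<close>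

text \<open>\<open>Z\<^sub>n \<rightarrow> c\<close> in probability is \<open>(\<lambda>(n, \<omega>). Z n \<omega>) \<longlongrightarrow> c\<close> along this filter, so that the limit
  calculus of the library replaces the usual \<open>o\<^sub>P\<close> arguments.\<close>

definition prob_filter :: "'a measure \<Rightarrow> (nat \<times> 'a) filter" where
  "prob_filter M = Abs_filter (\<lambda>P. \<exists>B. (\<forall>n. B n \<in> sets M) \<and> (\<lambda>n. measure M (B n)) \<longlonglongrightarrow> 0 \<and>
     (\<forall>n. \<forall>\<omega>\<in>space M - B n. P (n, \<omega>)))"

lemma eventually_prob_filter:
  "eventually P (prob_filter M) \<longleftrightarrow> (\<exists>B. (\<forall>n. B n \<in> sets M) \<and>
     (\<lambda>n. measure M (B n)) \<longlonglongrightarrow> 0 \<and> (\<forall>n. \<forall>\<omega>\<in>space M - B n. P (n, \<omega>)))"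
  unfolding prob_filter_def
proof (rule eventually_Abs_filter, rule is_filter.intro, goal_cases)
  case 1
  show ?case by (intro exI[of _ "\<lambda>_. {}"]) simp
next
  case (2 P Q)
  then obtain B C where B: "\<And>n. B n \<in> sets M" "(\<lambda>n. measure M (B n)) \<longlonglongrightarrow> 0"
      "\<And>n \<omega>. \<omega> \<in> space M - B n \<Longrightarrow> P (n, \<omega>)"
    and C: "\<And>n. C n \<in> sets M" "(\<lambda>n. measure M (C n)) \<longlonglongrightarrow> 0"
      "\<And>n \<omega>. \<omega> \<in> space M - C n \<Longrightarrow> Q (n, \<omega>)"
    by blast
  have "(\<lambda>n. measure M (B n \<union> C n)) \<longlonglongrightarrow> 0"
  proof (rule tendsto_sandwich[OF _ _ tendsto_const])
    show "(\<lambda>n. measure M (B n) + measure M (C n)) \<longlonglongrightarrow> 0"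
      using tendsto_add[OF B(2) C(2)] by simp
  qed (auto intro!: always_eventually measure_Un_le B C)
  then show ?case
    using B C by (intro exI[of _ "\<lambda>n. B n \<union> C n"]) auto
next
  case (3 P Q)
  then show ?case by meson
qed

lemma eventually_prob_filter_sequentially:
  assumes "eventually P sequentially"
  shows "eventually (\<lambda>(n, \<omega>). P n) (prob_filter M)"
proof -
  \<comment> \<open>Where \<open>P n\<close> fails, the whole space is exceptional; this concerns
    finitely many \<open>n\<close> only.\<close>
  define B where "B n = (if P n then {} else space M)" for n
  have "(\<lambda>n. measure M (B n)) \<longlonglongrightarrow> 0"
    by (rule tendsto_eventually, rule eventually_mono[OF assms]) (simp add: B_def)
  then show ?thesis
    unfolding eventually_prob_filter by (intro exI[of _ B]) (auto simp: B_def)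
qed

lemma tendsto_prob_filter_sequentially:
  assumes "(f \<longlongrightarrow> l) sequentially"
  shows "((\<lambda>z. f (fst z)) \<longlongrightarrow> l) (prob_filter M)"
proof (rule topological_tendstoI)
  fix S assume "open S" "l \<in> S"
  from eventually_prob_filter_sequentially[OF topological_tendstoD[OF assms this], of M]
  show "\<forall>\<^sub>F z in prob_filter M. f (fst z) \<in> S"
    by (auto elim!: eventually_mono)
qed

text \<open>The filter lives on all pairs, points outside \<open>space M\<close> included, whereas
  the estimator is constrained only on \<open>space M\<close>.\<close>

lemma eventually_in_space_prob_filter: "eventually (\<lambda>z. snd z \<in> space M) (prob_filter M)"
  unfolding eventually_prob_filter by (intro exI[of _ "\<lambda>_. {}"]) auto

text \<open>Off the exceptional set the integrand is below \<open>e / 2\<close>; on it the bound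
  \<open>C\<close> is multiplied by a vanishing probability.\<close>

lemma (in prob_space) bounded_convergence_prob_filter:
  fixes Z :: "nat \<Rightarrow> 'a \<Rightarrow> 'b::{banach, second_countable_topology}"
  assumes [measurable]: "\<And>n. Z n \<in> borel_measurable M"
    and bound: "\<And>n \<omega>. norm (Z n \<omega>) \<le> C"
    and conv: "((\<lambda>(n, \<omega>). Z n \<omega>) \<longlongrightarrow> 0) (prob_filter M)"
  shows "(\<lambda>n. expectation (Z n)) \<longlonglongrightarrow> 0"
proof (rule LIMSEQ_I)
  fix e :: real assume "e > 0"
  have int: "integrable M (Z n)" for n
    by (rule integrable_const_bound[of _ C]) (use bound in auto)
  have "C \<ge> 0"
    using norm_ge_zero[of "Z 0 undefined"] bound[of 0 undefined] by linarith
  from tendstoD[OF conv, of "e / 2"] \<open>e > 0\<close>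
  obtain B where B[measurable]: "\<And>n. B n \<in> sets M" and lim: "(\<lambda>n. prob (B n)) \<longlonglongrightarrow> 0"
    and small: "\<And>n \<omega>. \<omega> \<in> space M - B n \<Longrightarrow> norm (Z n \<omega>) < e / 2"
    by (auto simp: eventually_prob_filter)
  have "(\<lambda>n. C * prob (B n)) \<longlonglongrightarrow> 0"
    using tendsto_mult_right_zero[OF lim] .
  from LIMSEQ_D[OF this, of "e / 2"] \<open>e > 0\<close>
  obtain N where N: "\<And>n. n \<ge> N \<Longrightarrow> C * prob (B n) < e / 2"
    using \<open>C \<ge> 0\<close> by auto
  have "norm (expectation (Z n) - 0) < e" if "n \<ge> N" for n
  proof -
    have "norm (expectation (Z n)) \<le> expectation (\<lambda>\<omega>. norm (Z n \<omega>))"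
      by (rule integral_norm_bound)
    also have "\<dots> \<le> expectation (\<lambda>\<omega>. e / 2 + C * indicator (B n) \<omega>)"
    proof (rule integral_mono)
      show "integrable M (\<lambda>\<omega>. norm (Z n \<omega>))" using int by simp
      show "integrable M (\<lambda>\<omega>. e / 2 + C * indicator (B n) \<omega>)"
        by (intro Bochner_Integration.integrable_add integrable_mult_right integrable_const
            integrable_real_indicator) (auto simp: less_top[symmetric])
      fix \<omega> assume "\<omega> \<in> space M"
      then show "norm (Z n \<omega>) \<le> e / 2 + C * indicator (B n) \<omega>"
        using bound[of n \<omega>] small[of \<omega> n] \<open>e > 0\<close> by (cases "\<omega> \<in> B n") auto
    qed
    also have "\<dots> = e / 2 + C * prob (B n)"
      by (subst Bochner_Integration.integral_add)
         (auto simp: prob_space less_top[symmetric] intro!: integrable_mult_right integrable_real_indicator)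
    finally show ?thesis using N[OF that] by simp
  qed
  then show "\<exists>N. \<forall>n\<ge>N. norm (expectation (Z n) - 0) < e" by blast
qed

text \<open>Boundedness in probability, expressed through the products it tolerates.\<close>

definition tight_along :: "'a filter \<Rightarrow> ('a \<Rightarrow> real) \<Rightarrow> bool" where
  "tight_along F X \<longleftrightarrow> (\<forall>r. (r \<longlongrightarrow> 0) F \<longrightarrow> ((\<lambda>z. r z * X z) \<longlongrightarrow> (0::real)) F)"

lemma tight_alongD: "tight_along F X \<Longrightarrow> (r \<longlongrightarrow> 0) F \<Longrightarrow> ((\<lambda>z. r z * X z) \<longlongrightarrow> 0) F"
  by (simp add: tight_along_def)

lemma tight_along_tendsto: "(X \<longlongrightarrow> l) F \<Longrightarrow> tight_along F X"
  by (auto simp: tight_along_def dest: tendsto_mult)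

lemma tight_along_add: "tight_along F X \<Longrightarrow> tight_along F Z \<Longrightarrow> tight_along F (\<lambda>z. X z + Z z)"
  by (auto simp: tight_along_def distrib_left intro!: tendsto_add_zero)

lemma tight_along_cmult: "tight_along F X \<Longrightarrow> tight_along F (\<lambda>z. c * X z)"
  by (auto simp: tight_along_def mult.left_commute intro!: tendsto_mult_right_zero)

lemma tight_along_mono:
  assumes "tight_along F X" "eventually (\<lambda>z. \<bar>Z z\<bar> \<le> \<bar>X z\<bar>) F"
  shows "tight_along F Z"
  unfolding tight_along_def
proof safe
  fix r :: "'a \<Rightarrow> real" assume "(r \<longlongrightarrow> 0) F"
  then have "((\<lambda>z. r z * X z) \<longlongrightarrow> 0) F"
    using assms(1) by (rule tight_alongD[rotated])
  moreover have "eventually (\<lambda>z. norm (r z * Z z) \<le> norm (r z * X z) * 1) F"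
    using assms(2) by eventually_elim (simp add: abs_mult mult_left_mono)
  ultimately show "((\<lambda>z. r z * Z z) \<longlongrightarrow> 0) F"
    by (rule tendsto_0_le)
qed

lemma tight_along_abs: "tight_along F X \<Longrightarrow> tight_along F (\<lambda>z. \<bar>X z\<bar>)"
  by (rule tight_along_mono) auto

lemma tight_along_sum:
  "(\<And>i. i \<in> I \<Longrightarrow> tight_along F (X i)) \<Longrightarrow> tight_along F (\<lambda>z. \<Sum>i\<in>I. X i z)"
  by (induction I rule: infinite_finite_induct)
     (auto intro!: tight_along_add tight_along_tendsto[OF tendsto_const])

text \<open>By Chebyshev \<open>\<bar>X n\<bar>\<close> reaches \<open>Suc k\<close> with
  probability at most \<open>C / (Suc k)\<^sup>2\<close>, and \<open>r\<close> is below
  \<open>e / Suc k\<close> off sets vanishing in probability. For fixed \<open>k\<close> the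
  Chebyshev part does not tend to 0 with \<open>n\<close>, while the filter wants one sequence of
  exceptional sets, so \<open>k\<close> has to depend on \<open>n\<close>.\<close>

lemma (in prob_space) tight_along_prob_filterI:
  assumes [measurable]: "\<And>n. X n \<in> borel_measurable M"
    and int: "\<And>n. integrable M (\<lambda>\<omega>. (X n \<omega>)\<^sup>2)"
    and bound: "\<And>n. expectation (\<lambda>\<omega>. (X n \<omega>)\<^sup>2) \<le> C"
  shows "tight_along (prob_filter M) (\<lambda>(n, \<omega>). X n \<omega>)"
  unfolding tight_along_def
proof (intro allI impI tendstoI)
  fix r :: "nat \<times> 'a \<Rightarrow> real" and e :: real assume r: "(r \<longlongrightarrow> 0) (prob_filter M)" and "e > 0"
  have "C \<ge> 0"
    by (rule order_trans[OF _ bound[of 0]]) simp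
  have "\<forall>k::nat. \<exists>B. (\<forall>n. B n \<in> sets M) \<and> (\<lambda>n. prob (B n)) \<longlonglongrightarrow> 0 \<and>
      (\<forall>n. \<forall>\<omega>\<in>space M - B n. \<bar>r (n, \<omega>)\<bar> < e / Suc k)"
    using tendstoD[OF r, of "e / Suc k" for k] \<open>e > 0\<close> by (auto simp: eventually_prob_filter)
  then obtain B where B[measurable]: "\<And>k n. B k n \<in> sets M"
    and lim: "\<And>k. (\<lambda>n. prob (B k n)) \<longlonglongrightarrow> 0"
    and small: "\<And>k n \<omega>. \<omega> \<in> space M - B k n \<Longrightarrow> \<bar>r (n, \<omega>)\<bar> < e / Suc k"
    by metis
  define T where "T k n = {\<omega> \<in> space M. \<bar>X n \<omega>\<bar> \<ge> real (Suc k)}" for k n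
  have [measurable]: "T k n \<in> sets M" for k n unfolding T_def by measurable
  have T: "prob (T k n) \<le> C / (real (Suc k))\<^sup>2" for k n
  proof -
    have "prob (T k n) \<le> expectation (\<lambda>\<omega>. (X n \<omega>)\<^sup>2) / (real (Suc k))\<^sup>2"
      using second_moment_method[of "X n" "real (Suc k)"] int by (simp add: T_def)
    also have "\<dots> \<le> C / (real (Suc k))\<^sup>2"
      using bound by (intro divide_right_mono) auto
    finally show ?thesis .
  qed
  have lt: "\<bar>r (n, \<omega>) * X n \<omega>\<bar> < e" if "\<omega> \<in> space M - (B k n \<union> T k n)" for k n \<omega>
  proof -
    have "\<bar>r (n, \<omega>)\<bar> < e / Suc k" "\<bar>X n \<omega>\<bar> \<le> Suc k"
      using small[of \<omega> k n] that by (auto simp: T_def)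
    then have "\<bar>r (n, \<omega>)\<bar> * \<bar>X n \<omega>\<bar> \<le> \<bar>r (n, \<omega>)\<bar> * Suc k"
      by (intro mult_left_mono) auto
    also have "\<dots> < e"
      using \<open>\<bar>r (n, \<omega>)\<bar> < e / Suc k\<close> by (simp add: pos_less_divide_eq)
    finally show ?thesis by (simp add: abs_mult)
  qed
  text \<open>The exceptional set uses the best \<open>k \<le> n\<close>, so that no measurability of \<open>r\<close> is needed.\<close>
  define K where "K n = (ARG_MIN (\<lambda>k. prob (B k n \<union> T k n)) k. k \<le> n)" for n
  have K: "prob (B (K n) n \<union> T (K n) n) \<le> prob (B k n \<union> T k n)" if "k \<le> n" for k n
    using arg_min_if_finite(2)[of "{..n}" "\<lambda>k. prob (B k n \<union> T k n)"] that
    unfolding K_def arg_min_on_def by (fastforce simp: not_less)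
  have "(\<lambda>n. prob (B (K n) n \<union> T (K n) n)) \<longlonglongrightarrow> 0"
  proof (rule LIMSEQ_I)
    fix d :: real assume "d > 0"
    \<comment> \<open>A fixed \<open>k\<close> makes the Chebyshev part small, then a large
      \<open>n \<ge> k\<close> the other part; the minimizer \<open>K n\<close> does no worse than
      this \<open>k\<close>.\<close>
    have "(\<lambda>k. C / (real (Suc k))\<^sup>2) \<longlonglongrightarrow> 0"
      by (intro real_tendsto_divide_at_top tendsto_const filterlim_pow_at_top
          filterlim_compose[OF filterlim_real_sequentially filterlim_Suc]) auto
    then have "\<forall>\<^sub>F k in sequentially. C / (real (Suc k))\<^sup>2 < d / 2"
      using \<open>d > 0\<close> by (intro order_tendstoD(2)) auto
    then obtain k where k: "C / (real (Suc k))\<^sup>2 < d / 2"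
      by (auto simp: eventually_sequentially)
    have "\<forall>\<^sub>F n in sequentially. prob (B k n) < d / 2"
      using lim[of k] \<open>d > 0\<close> by (intro order_tendstoD(2)) auto
    moreover have "\<forall>\<^sub>F n in sequentially. k \<le> n"
      by (rule eventually_ge_at_top)
    ultimately have "\<forall>\<^sub>F n in sequentially. norm (prob (B (K n) n \<union> T (K n) n)) < d"
    proof eventually_elim
      case (elim n)
      have "prob (B k n \<union> T k n) \<le> prob (B k n) + prob (T k n)"
        by (intro measure_Un_le) auto
      then show ?case using K[OF elim(2)] T[of k n] k elim(1) by (simp only: real_norm_def abs_of_nonneg[OF measure_nonneg])
    qed
    then show "\<exists>N. \<forall>n\<ge>N. norm (prob (B (K n) n \<union> T (K n) n) - 0) < d"
      by (simp add: eventually_sequentially)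
  qed
  then show "\<forall>\<^sub>F z in prob_filter M. dist (r z * (case z of (n, \<omega>) \<Rightarrow> X n \<omega>)) 0 < e"
    unfolding eventually_prob_filter
    using lt by (intro exI[of _ "\<lambda>n. B (K n) n \<union> T (K n) n"]) auto
qed

subsection \<open>Limit theorems for i.i.d. sums\<close>

lemma cmod_iexp_diff_le: "cmod (iexp a - iexp b) \<le> \<bar>a - b\<bar>"
proof -
  have "iexp a - iexp b = iexp b * (iexp (a - b) - 1)"
    by (simp add: right_diff_distrib flip: exp_add)
  then show ?thesis
    using iexp_approx1[of "a - b" 0] by (simp add: norm_mult)
qed

text \<open>The function \<open>iexp (t * x)\<close> of \<open>x\<close> is bounded and Lipschitz,
  so bounded convergence applies to the difference of the two integrands.\<close>

lemma (in prob_space) slutsky_char: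
  fixes S T :: "nat \<Rightarrow> 'a \<Rightarrow> real"
  assumes [measurable]: "\<And>n. S n \<in> borel_measurable M" "\<And>n. T n \<in> borel_measurable M"
    and diff: "((\<lambda>(n, \<omega>). T n \<omega> - S n \<omega>) \<longlongrightarrow> 0) (prob_filter M)"
    and S: "\<And>t. (\<lambda>n. char (distr M borel (S n)) t) \<longlonglongrightarrow> char N t"
  shows "(\<lambda>n. char (distr M borel (T n)) t) \<longlonglongrightarrow> char N t"
proof -
  have int: "integrable M (\<lambda>\<omega>. iexp (t * Z \<omega>))" if [measurable]: "Z \<in> borel_measurable M" for Z
    by (rule integrable_const_bound[of _ 1]) auto
  have "(\<lambda>n. expectation (\<lambda>\<omega>. iexp (t * T n \<omega>) - iexp (t * S n \<omega>))) \<longlonglongrightarrow> 0"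
  proof (rule bounded_convergence_prob_filter)
    show "cmod (iexp (t * T n \<omega>) - iexp (t * S n \<omega>)) \<le> 2" for n \<omega>
      using norm_triangle_ineq4[of "iexp (t * T n \<omega>)" "iexp (t * S n \<omega>)"] by simp
    show "((\<lambda>(n, \<omega>). iexp (t * T n \<omega>) - iexp (t * S n \<omega>)) \<longlongrightarrow> 0) (prob_filter M)"
    proof (rule tendsto_0_le[OF diff, of _ "\<bar>t\<bar>"], rule always_eventually, safe, goal_cases)
      case (1 n \<omega>)
      show ?case
        using cmod_iexp_diff_le[of "t * T n \<omega>" "t * S n \<omega>"]
        by (simp add: abs_mult mult.commute flip: right_diff_distrib)
    qed
  qed simp
  also have "(\<lambda>n. expectation (\<lambda>\<omega>. iexp (t * T n \<omega>) - iexp (t * S n \<omega>)))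
      = (\<lambda>n. char (distr M borel (T n)) t - char (distr M borel (S n)) t)"
  proof
    fix n
    show "expectation (\<lambda>\<omega>. iexp (t * T n \<omega>) - iexp (t * S n \<omega>))
        = char (distr M borel (T n)) t - char (distr M borel (S n)) t"
      using int[of "T n"] int[of "S n"] by (simp add: char_def integral_distr)
  qed
  finally have "(\<lambda>n. char (distr M borel (T n)) t - char (distr M borel (S n)) t) \<longlonglongrightarrow> 0" .
  from tendsto_add[OF this S[of t]] show ?thesis by simp
qed

lemma char_scaled_std_normal:
  "char (distr std_normal_distribution borel ((*) s)) t = exp (- (s * t)\<^sup>2 / 2)"
proof -
  have "char (distr std_normal_distribution borel ((*) s)) t = char std_normal_distribution (s * t)"
    by (simp add: char_def integral_distr mult_ac)
  then show ?thesis by (simp add: char_std_normal_distribution)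
qed

locale iid_sample = prob_space M for M :: "'a measure" +
  fixes P :: "'b::{second_countable_topology, t2_space} measure" and X :: "nat \<Rightarrow> 'a \<Rightarrow> 'b"
  assumes indep: "indep_vars (\<lambda>_. borel) X UNIV"
    and distributed: "\<And>i. distr M borel (X i) = P"
begin

lemma sets_P [measurable_cong]: "sets P = sets borel"
  using distributed[of 0] by auto

lemma X_measurable [measurable]: "X i \<in> borel_measurable M"
  using indep by (auto simp: indep_vars_def2)

lemma prob_space_P: "prob_space P"
  using prob_space_distr[OF X_measurable[of 0]] by (simp add: distributed)

lemma integral_X:
  fixes f :: "'b \<Rightarrow> real" assumes [measurable]: "f \<in> borel_measurable borel"
  shows "expectation (\<lambda>\<omega>. f (X i \<omega>)) = (\<integral>x. f x \<partial>P)"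
  by (subst distributed[of i, symmetric]) (simp add: integral_distr)

lemma integrable_X:
  fixes f :: "'b \<Rightarrow> real" assumes [measurable]: "f \<in> borel_measurable borel"
  shows "integrable M (\<lambda>\<omega>. f (X i \<omega>)) \<longleftrightarrow> integrable P f"
  by (subst distributed[of i, symmetric]) (simp add: integrable_distr_eq)

context
  fixes f :: "'b \<Rightarrow> real"
  assumes f_measurable [measurable]: "f \<in> borel_measurable borel"
    and f_square: "integrable P (\<lambda>x. (f x)\<^sup>2)"
    and f_mean: "(\<integral>x. f x \<partial>P) = 0"
begin

lemma integrable_f: "integrable P f"
proof -
  interpret P: prob_space P by (rule prob_space_P)
  show ?thesis
    by (rule P.square_integrable_imp_integrable) (use f_square in auto)
qed

text \<open>Independence and mean zero kill the off-diagonal products, so the second moment grows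
  linearly in \<open>n\<close>.\<close>

lemma second_moment_sum:
  "integrable M (\<lambda>\<omega>. (\<Sum>i<n. f (X i \<omega>))\<^sup>2)"
  "expectation (\<lambda>\<omega>. (\<Sum>i<n. f (X i \<omega>))\<^sup>2) = n * (\<integral>x. (f x)\<^sup>2 \<partial>P)"
proof -
  have prod: "integrable M (\<lambda>\<omega>. f (X i \<omega>) * f (X j \<omega>)) \<and>
      expectation (\<lambda>\<omega>. f (X i \<omega>) * f (X j \<omega>)) = (if i = j then (\<integral>x. (f x)\<^sup>2 \<partial>P) else 0)" for i j
  proof (cases "i = j")
    case True
    then show ?thesis
      using integrable_X[of "\<lambda>x. (f x)\<^sup>2"] integral_X[of "\<lambda>x. (f x)\<^sup>2"] f_square
      by (simp add: power2_eq_square)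
  next
    case False
    have "indep_vars (\<lambda>_. borel) (\<lambda>i \<omega>. f (X i \<omega>)) {i, j}"
      by (rule indep_vars_compose2[OF indep_vars_subset[OF indep]]) auto
    note prod = indep_vars_lebesgue_integral[OF _ this] indep_vars_integrable[OF _ this]
    show ?thesis
      using prod False by (simp add: integrable_X integral_X integrable_f f_mean)
  qed
  have eq: "(\<Sum>i<n. f (X i \<omega>))\<^sup>2 = (\<Sum>i<n. \<Sum>j<n. f (X i \<omega>) * f (X j \<omega>))" for \<omega>
    by (simp add: power2_eq_square sum_product)
  show "integrable M (\<lambda>\<omega>. (\<Sum>i<n. f (X i \<omega>))\<^sup>2)"
    unfolding eq using prod by auto
  show "expectation (\<lambda>\<omega>. (\<Sum>i<n. f (X i \<omega>))\<^sup>2) = n * (\<integral>x. (f x)\<^sup>2 \<partial>P)"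
    unfolding eq using prod by (simp add: Bochner_Integration.integral_sum)
qed

lemma tight_normalized_sum:
  "tight_along (prob_filter M) (\<lambda>(n, \<omega>). (\<Sum>i<n. f (X i \<omega>)) / sqrt n)"
proof (rule tight_along_prob_filterI)
  fix n
  show "integrable M (\<lambda>\<omega>. ((\<Sum>i<n. f (X i \<omega>)) / sqrt n)\<^sup>2)"
    using second_moment_sum(1)[of n] by (simp add: power_divide)
  show "expectation (\<lambda>\<omega>. ((\<Sum>i<n. f (X i \<omega>)) / sqrt n)\<^sup>2) \<le> (\<integral>x. (f x)\<^sup>2 \<partial>P)"
    \<comment> \<open>For \<open>n = 0\<close> the quotient is 0 by the convention for division by
      zero.\<close>
    using second_moment_sum(2)[of n] by (cases "n = 0") (auto simp: power_divide)
qed simp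

text \<open>The central limit theorem applied here requires positive variance. If the variance is
  zero, the sums vanish almost surely and the limit, a point mass at 0, has characteristic function
  1 as well; degenerate directions of the limit covariance need this case.\<close>

lemma char_normalized_sum:
  "(\<lambda>n. char (distr M borel (\<lambda>\<omega>. (\<Sum>i<n. f (X i \<omega>)) / sqrt n)) t)
     \<longlonglongrightarrow> char (distr std_normal_distribution borel ((*) (sqrt (\<integral>x. (f x)\<^sup>2 \<partial>P)))) t"
proof (cases "(\<integral>x. (f x)\<^sup>2 \<partial>P) = 0")
  case True
  have zero: "char (distr M borel (\<lambda>\<omega>. (\<Sum>i<n. f (X i \<omega>)) / sqrt n)) t = 1" for n
  proof -
    have "AE \<omega> in M. (\<Sum>i<n. f (X i \<omega>))\<^sup>2 = 0"
      using second_moment_sum[of n] True integral_nonneg_eq_0_iff_AE[of M "\<lambda>\<omega>. (\<Sum>i<n. f (X i \<omega>))\<^sup>2"]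
      by simp
    then have "AE \<omega> in M. iexp (t * ((\<Sum>i<n. f (X i \<omega>)) / sqrt n)) = 1"
      by eventually_elim simp
    then have "expectation (\<lambda>\<omega>. iexp (t * ((\<Sum>i<n. f (X i \<omega>)) / sqrt n))) = expectation (\<lambda>\<omega>. 1)"
      by (intro integral_cong_AE) auto
    then show ?thesis by (simp add: char_def integral_distr prob_space)
  qed
  show ?thesis
    unfolding zero char_scaled_std_normal True by simp
next
  case False
  define \<sigma> where "\<sigma> = sqrt (\<integral>x. (f x)\<^sup>2 \<partial>P)"
  have "(\<integral>x. (f x)\<^sup>2 \<partial>P) \<ge> 0" by simp
  with False have "\<sigma> > 0" and \<sigma>2: "\<sigma>\<^sup>2 = (\<integral>x. (f x)\<^sup>2 \<partial>P)"
    unfolding \<sigma>_def by (auto simp: less_le)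
  have "weak_conv_m (\<lambda>n. distr M borel (\<lambda>\<omega>. (\<Sum>i<n. f (X i \<omega>)) / sqrt (n * \<sigma>\<^sup>2))) std_normal_distribution"
  proof (rule central_limit_theorem_zero_mean)
    show "indep_vars (\<lambda>i. borel) (\<lambda>i \<omega>. f (X i \<omega>)) UNIV"
      by (rule indep_vars_compose2[OF indep]) simp
    show mean: "expectation (\<lambda>\<omega>. f (X n \<omega>)) = 0" for n
      by (simp add: integral_X f_mean)
    show "integrable M (\<lambda>\<omega>. (f (X n \<omega>))\<^sup>2)" for n
      using integrable_X[of "\<lambda>x. (f x)\<^sup>2"] f_square by simp
    show "expectation (\<lambda>\<omega>. (f (X n \<omega>) - expectation (\<lambda>\<omega>. f (X n \<omega>)))\<^sup>2) = \<sigma>\<^sup>2" for n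
      using integral_X[of "\<lambda>x. (f x)\<^sup>2"] by (simp add: mean \<sigma>2)
    show "distr M borel (\<lambda>\<omega>. f (X n \<omega>)) = distr P borel f" for n
      by (subst distributed[of n, symmetric]) (simp add: distr_distr comp_def)
  qed fact
  \<comment> \<open>The theorem also divides by the standard deviation; evaluating at
    \<open>\<sigma> * t\<close> undoes this.\<close>
  then have "(\<lambda>n. char (distr M borel (\<lambda>\<omega>. (\<Sum>i<n. f (X i \<omega>)) / sqrt (n * \<sigma>\<^sup>2))) (\<sigma> * t))
      \<longlonglongrightarrow> char std_normal_distribution (\<sigma> * t)"
    by (intro levy_continuity1 real_dist_normal_dist) (auto intro!: real_distribution_distr)
  moreover have "char (distr M borel (\<lambda>\<omega>. (\<Sum>i<n. f (X i \<omega>)) / sqrt (n * \<sigma>\<^sup>2))) (\<sigma> * t)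
      = char (distr M borel (\<lambda>\<omega>. (\<Sum>i<n. f (X i \<omega>)) / sqrt n)) t" for n
    using \<open>\<sigma> > 0\<close> by (simp add: char_def integral_distr real_sqrt_mult field_simps)
  moreover have "char std_normal_distribution (\<sigma> * t) = char (distr std_normal_distribution borel ((*) \<sigma>)) t"
    by (simp add: char_scaled_std_normal char_std_normal_distribution)
  ultimately show ?thesis by (simp add: \<sigma>_def)
qed

end

text \<open>The centred sum divided by \<open>sqrt n\<close> is tight, and one more factor
  \<open>1 / sqrt n\<close> sends it to 0.\<close>

lemma weak_law_of_large_numbers:
  fixes f :: "'b \<Rightarrow> real"
  assumes [measurable]: "f \<in> borel_measurable borel" and f: "integrable P (\<lambda>x. (f x)\<^sup>2)"
  shows "((\<lambda>(n, \<omega>). (\<Sum>i<n. f (X i \<omega>)) / n) \<longlongrightarrow> (\<integral>x. f x \<partial>P)) (prob_filter M)"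
proof -
  interpret P: prob_space P by (rule prob_space_P)
  let ?m = "\<integral>x. f x \<partial>P"
  have int: "integrable P f"
    by (rule P.square_integrable_imp_integrable) (use f in auto)
  let ?S = "\<lambda>(n, \<omega>). (\<Sum>i<n. f (X i \<omega>) - ?m) / sqrt n"
  have "tight_along (prob_filter M) ?S"
  proof (rule tight_normalized_sum)
    show "integrable P (\<lambda>x. (f x - ?m)\<^sup>2)"
      using f int by (simp add: power2_diff)
    show "(\<integral>x. f x - ?m \<partial>P) = 0"
      using int by (simp add: P.prob_space)
  qed simp
  moreover have "((\<lambda>z. 1 / sqrt (fst z)) \<longlongrightarrow> 0) (prob_filter M)"
    by (rule tendsto_prob_filter_sequentially, real_asymp)
  ultimately have "((\<lambda>z. 1 / sqrt (fst z) * ?S z) \<longlongrightarrow> 0) (prob_filter M)"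
    by (rule tight_alongD)
  then have "((\<lambda>z. 1 / sqrt (fst z) * ?S z + ?m) \<longlongrightarrow> ?m) (prob_filter M)"
    using tendsto_add[OF _ tendsto_const] by fastforce
  then show ?thesis
  proof (rule Lim_transform_eventually)
    \<comment> \<open>At \<open>n = 0\<close> the left-hand side below is \<open>?m\<close>, the
      right-hand side 0.\<close>
    have "\<forall>\<^sub>F (n, \<omega>) in prob_filter M. n > (0::nat)"
      by (rule eventually_prob_filter_sequentially) (rule eventually_gt_at_top)
    then show "\<forall>\<^sub>F z in prob_filter M. 1 / sqrt (fst z) * ?S z + ?m = (case z of (n, \<omega>) \<Rightarrow> (\<Sum>i<n. f (X i \<omega>)) / n)"
      by eventually_elim (auto simp: sum_subtractf field_simps)
  qed
qed

end

subsection \<open>The Cramer-Wold device\<close>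

text \<open>Real trigonometric polynomials. The phase \<open>a\<close> covers sines and constants,
  and each generator depends on \<open>x\<close> only through one projection
  \<open>t \<bullet> x\<close>.\<close>

inductive trig_sum :: "('a::real_inner \<Rightarrow> real) \<Rightarrow> bool" where
  trig_sum_cos: "trig_sum (\<lambda>x. cos (t \<bullet> x + a))"
| trig_sum_add: "trig_sum f \<Longrightarrow> trig_sum g \<Longrightarrow> trig_sum (\<lambda>x. f x + g x)"
| trig_sum_cmult: "trig_sum f \<Longrightarrow> trig_sum (\<lambda>x. c * f x)"

lemma trig_sum_const: "trig_sum (\<lambda>x. c)"
  using trig_sum_cmult[OF trig_sum_cos[of 0 0], of c] by simp

lemma trig_sum_sum: "(\<And>i. i \<in> I \<Longrightarrow> trig_sum (f i)) \<Longrightarrow> trig_sum (\<lambda>x. \<Sum>i\<in>I. f i x)"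
  by (induction I rule: infinite_finite_induct) (auto intro: trig_sum_const trig_sum_add)

lemma trig_sum_sin: "trig_sum (\<lambda>x. sin (t \<bullet> x))"
  using trig_sum_cos[of t "- (pi / 2)"] by (simp add: cos_diff)

text \<open>Product-to-sum formula, by induction on both factors; closure under products is what
  admits polynomials in the sines.\<close>

lemma trig_sum_mult:
  assumes "trig_sum f" "trig_sum g"
  shows "trig_sum (\<lambda>x. f x * g x)"
  using assms(1)
proof induction
  case (trig_sum_cos t a)
  show ?case
    using assms(2)
  proof induction
    case (trig_sum_cos u b)
    have "(\<lambda>x. cos (t \<bullet> x + a) * cos (u \<bullet> x + b))
        = (\<lambda>x. 1 / 2 * (cos ((t - u) \<bullet> x + (a - b)) + cos ((t + u) \<bullet> x + (a + b))))"
      by (rule ext, subst cos_times_cos) (simp add: inner_diff_left inner_add_left algebra_simps)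
    then show ?case
      by (simp only:) (intro trig_sum.intros)
  next
    case (trig_sum_add f g)
    from trig_sum.trig_sum_add[OF trig_sum_add.IH] show ?case by (simp add: distrib_left)
  next
    case (trig_sum_cmult f c)
    from trig_sum.trig_sum_cmult[OF trig_sum_cmult.IH, of c] show ?case by (simp add: mult.left_commute)
  qed
next
  case (trig_sum_add f g)
  from trig_sum.trig_sum_add[OF trig_sum_add.IH] show ?case by (simp add: distrib_right)
next
  case (trig_sum_cmult f c)
  from trig_sum.trig_sum_cmult[OF trig_sum_cmult.IH, of c] show ?case by (simp add: mult.assoc)
qed

lemma trig_sum_bounded: "trig_sum f \<Longrightarrow> \<exists>C. \<forall>x. \<bar>f x\<bar> \<le> C"
proof (induction rule: trig_sum.induct)
  case (trig_sum_cos t a)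
  then show ?case by (meson abs_cos_le_one)
next
  case (trig_sum_add f g)
  then show ?case by (meson abs_triangle_ineq add_mono order_trans)
next
  case (trig_sum_cmult f c)
  then show ?case by (metis abs_ge_zero abs_mult mult_left_mono)
qed

lemma trig_sum_continuous: "trig_sum f \<Longrightarrow> continuous_on UNIV f"
  by (induction rule: trig_sum.induct) (auto intro!: continuous_intros)

context
  fixes \<mu> :: "nat \<Rightarrow> 'a::euclidean_space measure" and \<nu> :: "'a measure"
  assumes \<mu>: "\<And>n. prob_space (\<mu> n)" "\<And>n. sets (\<mu> n) = sets borel"
    and \<nu>: "prob_space \<nu>" "sets \<nu> = sets borel"
    and projections: "\<And>t. weak_conv_m (\<lambda>n. distr (\<mu> n) borel (\<lambda>x. t \<bullet> x)) (distr \<nu> borel (\<lambda>x. t \<bullet> x))"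
begin

lemma projection_integral_conv:
  assumes "\<And>y. isCont g y" "\<And>y. \<bar>g y\<bar> \<le> (C::real)"
  shows "(\<lambda>n. \<integral>x. g (t \<bullet> x) \<partial>\<mu> n) \<longlonglongrightarrow> (\<integral>x. g (t \<bullet> x) \<partial>\<nu>)"
proof -
  have [measurable]: "g \<in> borel_measurable borel"
    by (intro borel_measurable_continuous_onI continuous_at_imp_continuous_on) (use assms in auto)
  have [measurable]: "(\<lambda>x. t \<bullet> x) \<in> borel_measurable (\<mu> n)" "(\<lambda>x. t \<bullet> x) \<in> borel_measurable \<nu>" for n
    using \<mu>(2) \<nu>(2) by (auto cong: measurable_cong_sets)
  have "(\<lambda>n. integral\<^sup>L (distr (\<mu> n) borel (\<lambda>x. t \<bullet> x)) g)
      \<longlonglongrightarrow> integral\<^sup>L (distr \<nu> borel (\<lambda>x. t \<bullet> x)) g"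
    using assms \<mu> \<nu>
    by (intro weak_conv_imp_integral_bdd_continuous_conv[OF _ _ projections]
        prob_space.real_distribution_distr) auto
  then show ?thesis by (simp add: integral_distr)
qed

lemma integrable_bounded_continuous:
  fixes f :: "'a \<Rightarrow> real"
  assumes "continuous_on UNIV f" "\<And>x. \<bar>f x\<bar> \<le> C"
  shows "integrable (\<mu> n) f" "integrable \<nu> f"
proof -
  have [measurable]: "f \<in> borel_measurable borel"
    using assms(1) by (rule borel_measurable_continuous_onI)
  have "f \<in> borel_measurable (\<mu> n)" "f \<in> borel_measurable \<nu>"
    using \<mu>(2) \<nu>(2) by (auto cong: measurable_cong_sets)
  then show "integrable (\<mu> n) f" "integrable \<nu> f"
    using assms(2) \<mu>(1) \<nu>(1)
    by (auto intro!: finite_measure.integrable_const_bound[of _ _ C] prob_space.finite_measure)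
qed

lemma trig_sum_integral_conv:
  "trig_sum f \<Longrightarrow> (\<lambda>n. \<integral>x. f x \<partial>\<mu> n) \<longlonglongrightarrow> (\<integral>x. f x \<partial>\<nu>)"
proof (induction rule: trig_sum.induct)
  case (trig_sum_cos t a)
  show ?case
    by (rule projection_integral_conv[of "\<lambda>y. cos (y + a)" 1]) (auto intro!: continuous_intros)
next
  case (trig_sum_add f g)
  have "integrable (\<mu> n) f" "integrable \<nu> f" "integrable (\<mu> n) g" "integrable \<nu> g" for n
    using trig_sum_add.hyps trig_sum_continuous trig_sum_bounded integrable_bounded_continuous by metis+
  then show ?case
    using tendsto_add[OF trig_sum_add.IH] by simp
next
  case (trig_sum_cmult f c)
  then show ?case by (simp add: tendsto_mult)
qed

text \<open>The map \<open>x \<mapsto> sin (c x)\<close>, applied coordinatewise, is injective on a large box, on which \<open>f\<close>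
  can therefore be written as a continuous function \<open>F\<close> of it. Since \<open>F (sin (c x))\<close> is bounded on the
  whole space by the bound for \<open>f\<close>, no truncation is needed off the box.\<close>

theorem cramer_wold:
  fixes f :: "'a \<Rightarrow> real"
  assumes f: "continuous_on UNIV f" and bound: "\<And>x. \<bar>f x\<bar> \<le> C"
  shows "(\<lambda>n. \<integral>x. f x \<partial>\<mu> n) \<longlonglongrightarrow> (\<integral>x. f x \<partial>\<nu>)"
proof (rule LIMSEQ_I)
  fix e :: real assume "e > 0"
  interpret \<nu>: prob_space \<nu> by fact
  interpret \<mu>: prob_space "\<mu> n" for n by fact
  have "C \<ge> 0" using abs_ge_zero[of "f 0"] bound[of 0] by linarith
  \<comment> \<open>A continuous bounded majorant of the indicator of
    \<open>\<bar>y\<bar> > L\<close> that tends to 0 pointwise as \<open>L\<close> grows. It depends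
    on one coordinate, so its integrals converge by the assumption on projections; this takes the
    place of a tightness argument for the \<open>\<mu> n\<close>.\<close>
  define h where "h L y = min 1 ((y / L)\<^sup>2)" for L y :: real
  have h: "isCont (h L) y" "\<bar>h L y\<bar> \<le> 1" if "L > 0" for L y
    proof -
    show "isCont (h L) y"
      unfolding h_def using that by (auto intro!: continuous_intros)
    have "0 \<le> h L y" "h L y \<le> 1" by (simp_all add: h_def)
    then show "\<bar>h L y\<bar> \<le> 1" by simp
  qed
  define tail where "tail L x = (\<Sum>b\<in>Basis. h L (b \<bullet> x))" for L and x :: 'a
  have int_h: "integrable (\<mu> n) (\<lambda>x. h L (b \<bullet> x))" "integrable \<nu> (\<lambda>x. h L (b \<bullet> x))"
    if "L > 0" for n L and b :: 'a
  proof -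
    have "continuous_on UNIV (\<lambda>x. h L (b \<bullet> x))"
      unfolding h_def using that by (intro continuous_intros) auto
    then show "integrable (\<mu> n) (\<lambda>x. h L (b \<bullet> x))" "integrable \<nu> (\<lambda>x. h L (b \<bullet> x))"
      using integrable_bounded_continuous h(2)[OF that] by blast+
  qed
  have "(\<lambda>m. \<integral>x. h (real (Suc m)) (b \<bullet> x) \<partial>\<nu>) \<longlonglongrightarrow> (\<integral>x. 0 \<partial>\<nu>)" for b
  proof (rule integral_dominated_convergence[where w = "\<lambda>_. 1"])
    show "AE x in \<nu>. (\<lambda>m. h (real (Suc m)) (b \<bullet> x)) \<longlonglongrightarrow> 0"
    proof (rule always_eventually, rule allI)
      fix x
      have "(\<lambda>m. ((b \<bullet> x) / real (Suc m))\<^sup>2) \<longlonglongrightarrow> 0"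
        using tendsto_power[OF LIMSEQ_Suc[OF lim_const_over_n[of "b \<bullet> x"]], of 2] by simp
      then have "(\<lambda>m. min 1 (((b \<bullet> x) / real (Suc m))\<^sup>2)) \<longlonglongrightarrow> min 1 0"
        by (intro tendsto_min tendsto_const)
      then show "(\<lambda>m. h (real (Suc m)) (b \<bullet> x)) \<longlonglongrightarrow> 0" by (simp add: h_def)
    qed
    show "(\<lambda>x. h (real (Suc m)) (b \<bullet> x)) \<in> borel_measurable \<nu>" for m
      using int_h(2)[of "real (Suc m)" b] by auto
    show "AE x in \<nu>. norm (h (real (Suc m)) (b \<bullet> x)) \<le> 1" for m
      using h(2)[of "real (Suc m)"] by auto
  qed auto
  then have "(\<lambda>m. \<integral>x. tail (real (Suc m)) x \<partial>\<nu>) \<longlonglongrightarrow> 0"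
    unfolding tail_def
    by (subst Bochner_Integration.integral_sum) (auto intro!: int_h tendsto_null_sum)
  \<comment> \<open>The approximation costs \<open>d + 2 * C * d\<close> under each of
    \<open>\<mu> n\<close> and \<open>\<nu>\<close>, the trigonometric part costs \<open>d\<close>;
    the total \<open>(4 * C + 3) * d\<close> is below
    \<open>4 * (2 * C + 2) * d = e\<close>.\<close>
  moreover define d where "d = e / (4 * (2 * C + 2))"
  have "d > 0" using \<open>e > 0\<close> \<open>C \<ge> 0\<close> by (simp add: d_def)
  ultimately have "\<forall>\<^sub>F m in sequentially. (\<integral>x. tail (real (Suc m)) x \<partial>\<nu>) < d"
    using order_tendstoD(2) by blast
  then obtain m where tail_\<nu>: "(\<integral>x. tail (real (Suc m)) x \<partial>\<nu>) < d"
    by (auto simp: eventually_sequentially)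
  define L where "L = real (Suc m)"
  have "L > 0" by (simp add: L_def)
  \<comment> \<open>Multiplication by \<open>c\<close> sends \<open>[- L, L]\<close> to
    \<open>[- pi / 2, pi / 2]\<close>, where \<open>arcsin\<close> inverts
    \<open>sin\<close>.\<close>
  define c where "c = pi / (2 * L)"
  have "c > 0" using \<open>L > 0\<close> by (simp add: c_def)
  define sines where "sines x = (\<Sum>b\<in>Basis. sin (c * (x \<bullet> b)) *\<^sub>R b)" for x :: 'a
  define F where "F u = f (\<Sum>b\<in>Basis. (arcsin (u \<bullet> b) / c) *\<^sub>R b)" for u :: 'a
  have sines_inner: "sines x \<bullet> b = sin (c * (x \<bullet> b))" if "b \<in> Basis" for x b
    using that by (simp add: sines_def inner_sum_left_Basis)
  have sines_box: "sines x \<in> cbox (- One) One" for x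
    by (simp add: mem_box sines_inner)
  have "continuous_on (cbox (- One) One) F"
    unfolding F_def
    by (intro continuous_on_compose2[OF f] continuous_intros continuous_on_arcsin)
       (use \<open>c > 0\<close> in \<open>auto simp: mem_box\<close>)
  then obtain g where g: "real_polynomial_function g"
    and Fg: "\<And>u. u \<in> cbox (- One) One \<Longrightarrow> \<bar>F u - g u\<bar> < d"
    using Stone_Weierstrass_real_polynomial_function[OF compact_cbox _ \<open>d > 0\<close>] by blast
  from g have trig: "trig_sum (\<lambda>x. g (sines x))"
  proof induction
    case (linear l)
    interpret bounded_linear l by fact
    have "(\<lambda>x. l (sines x)) = (\<lambda>x. \<Sum>b\<in>Basis. l b * sin ((c *\<^sub>R b) \<bullet> x))"
      by (simp add: sines_def sum scaleR inner_commute mult.commute)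
    then show ?case
      by (simp only:) (intro trig_sum_sum trig_sum_cmult trig_sum_sin)
  qed (auto intro: trig_sum_const trig_sum_add trig_sum_mult)
  have F_sines: "F (sines x) = f x" if "\<And>b. b \<in> Basis \<Longrightarrow> \<bar>b \<bullet> x\<bar> \<le> L" for x
  proof -
    have "arcsin (sin (c * (x \<bullet> b))) = c * (x \<bullet> b)" if "b \<in> Basis" for b
    proof -
      have "\<bar>c * (x \<bullet> b)\<bar> \<le> c * L"
        using \<open>c > 0\<close> \<open>\<And>b. b \<in> Basis \<Longrightarrow> \<bar>b \<bullet> x\<bar> \<le> L\<close>[OF that] by (simp add: abs_mult inner_commute)
      also have "c * L = pi / 2" using \<open>L > 0\<close> by (simp add: c_def)
      finally show ?thesis by (intro arcsin_sin) auto
    qed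
    then show ?thesis
      using \<open>c > 0\<close> by (simp add: F_def sines_inner euclidean_representation)
  qed
  \<comment> \<open>On the box \<open>f x\<close> equals \<open>F (sines x)\<close>; off it some
    coordinate makes \<open>tail L x \<ge> 1\<close>, which pays for the crude bound
    \<open>2 * C\<close>.\<close>
  have approx: "\<bar>f x - g (sines x)\<bar> \<le> d + 2 * C * tail L x" for x
  proof -
    have nonneg: "tail L x \<ge> 0" by (auto simp: tail_def h_def intro!: sum_nonneg)
    have "\<bar>f x - F (sines x)\<bar> \<le> 2 * C * tail L x"
    proof (cases "\<forall>b\<in>Basis. \<bar>b \<bullet> x\<bar> \<le> L")
      case True
      then show ?thesis using F_sines nonneg \<open>C \<ge> 0\<close> by simp
    next
      case False
      then obtain b where b: "b \<in> Basis" "\<bar>b \<bullet> x\<bar> > L" by force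
      have "1 \<le> ((b \<bullet> x) / L)\<^sup>2"
        using b \<open>L > 0\<close> abs_le_square_iff[of 1 "(b \<bullet> x) / L"] by simp
      then have "1 \<le> h L (b \<bullet> x)" by (simp add: h_def)
      also have "\<dots> \<le> tail L x"
        unfolding tail_def using b(1) by (intro member_le_sum) (auto simp: h_def)
      finally have "2 * C * 1 \<le> 2 * C * tail L x"
        using \<open>C \<ge> 0\<close> by (intro mult_left_mono) auto
      moreover have "\<bar>f x - F (sines x)\<bar> \<le> 2 * C"
        using bound[of x] bound[of "\<Sum>b\<in>Basis. (arcsin (sines x \<bullet> b) / c) *\<^sub>R b"]
        by (simp add: F_def)
      ultimately show ?thesis by simp
    qed
    then show ?thesis using Fg[OF sines_box[of x]] by linarith
  qed
  have int_f: "integrable (\<mu> n) f" "integrable \<nu> f" for n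
    using integrable_bounded_continuous[OF f bound] by auto
  obtain K where "\<And>x. \<bar>g (sines x)\<bar> \<le> K"
    using trig_sum_bounded[OF trig] by blast
  with trig_sum_continuous[OF trig]
  have int_g: "integrable (\<mu> n) (\<lambda>x. g (sines x))" "integrable \<nu> (\<lambda>x. g (sines x))" for n
    using integrable_bounded_continuous by blast+
  have int_tail: "integrable (\<mu> n) (tail L)" "integrable \<nu> (tail L)" for n
    unfolding tail_def using \<open>L > 0\<close> int_h by auto
  have approx_integral: "\<bar>(\<integral>x. f x \<partial>\<rho>) - (\<integral>x. g (sines x) \<partial>\<rho>)\<bar> \<le> d + 2 * C * (\<integral>x. tail L x \<partial>\<rho>)"
    if "prob_space \<rho>" "integrable \<rho> f" "integrable \<rho> (\<lambda>x. g (sines x))" "integrable \<rho> (tail L)" for \<rho>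
  proof -
    interpret \<rho>: prob_space \<rho> by fact
    have "\<bar>\<integral>x. f x - g (sines x) \<partial>\<rho>\<bar> \<le> (\<integral>x. \<bar>f x - g (sines x)\<bar> \<partial>\<rho>)"
      by (rule integral_abs_bound)
    also have "\<dots> \<le> (\<integral>x. d + 2 * C * tail L x \<partial>\<rho>)"
      using that approx by (intro integral_mono) auto
    finally show ?thesis using that by (simp add: \<rho>.prob_space)
  qed
  have "(\<lambda>n. \<integral>x. tail L x \<partial>\<mu> n) \<longlonglongrightarrow> (\<integral>x. tail L x \<partial>\<nu>)"
    unfolding tail_def
    by (simp add: Bochner_Integration.integral_sum int_h \<open>L > 0\<close>)
       (intro tendsto_sum projection_integral_conv[of "h L" 1] h \<open>L > 0\<close>)
  then have "\<forall>\<^sub>F n in sequentially. (\<integral>x. tail L x \<partial>\<mu> n) < d"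
    using tail_\<nu> by (intro order_tendstoD(2)) (auto simp: L_def)
  moreover have "\<forall>\<^sub>F n in sequentially. \<bar>(\<integral>x. g (sines x) \<partial>\<mu> n) - (\<integral>x. g (sines x) \<partial>\<nu>)\<bar> < d"
    using tendstoD[OF trig_sum_integral_conv[OF trig] \<open>d > 0\<close>] by (simp add: dist_real_def)
  ultimately have "\<forall>\<^sub>F n in sequentially. norm ((\<integral>x. f x \<partial>\<mu> n) - (\<integral>x. f x \<partial>\<nu>)) < e"
  proof eventually_elim
    case (elim n)
    have "2 * C * (\<integral>x. tail L x \<partial>\<mu> n) \<le> 2 * C * d" "2 * C * (\<integral>x. tail L x \<partial>\<nu>) \<le> 2 * C * d"
      using elim(1) tail_\<nu> \<open>C \<ge> 0\<close> by (auto intro!: mult_left_mono simp: L_def)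
    moreover have "d * (4 * (2 * C + 2)) = e"
      unfolding d_def using \<open>C \<ge> 0\<close> by (intro nonzero_eq_divide_eq[THEN iffD1]) auto
    then have "4 * (2 * C * d + 2 * d) = e" by (simp add: algebra_simps)
    moreover have "2 * C * d \<ge> 0" using \<open>C \<ge> 0\<close> \<open>d > 0\<close> by simp
    moreover have arith: "\<bar>a - b\<bar> < 4 * (m + 2 * d)"
      if "\<bar>a - k\<bar> \<le> d + r" "\<bar>b - l\<bar> \<le> d + s" "\<bar>k - l\<bar> < d" "r \<le> m" "s \<le> m" "m \<ge> 0"
      for a b k l r s m :: real
      using that \<open>d > 0\<close> unfolding abs_less_iff abs_le_iff by argo
    ultimately show ?case
      using arith[OF approx_integral[OF \<mu>(1) int_f(1) int_g(1) int_tail(1)]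
          approx_integral[OF \<nu>(1) int_f(2) int_g(2) int_tail(2)] elim(2)]
      unfolding real_norm_def by metis
  qed
  then show "\<exists>N. \<forall>n\<ge>N. norm ((\<integral>x. f x \<partial>\<mu> n) - (\<integral>x. f x \<partial>\<nu>)) < e"
    by (simp add: eventually_sequentially)
qed

end

subsection \<open>Multivariate normal distributions\<close>

definition psd_on :: "'i set \<Rightarrow> ('i \<Rightarrow> 'i \<Rightarrow> real) \<Rightarrow> bool" where
  "psd_on I S \<longleftrightarrow> (\<forall>i\<in>I. \<forall>j\<in>I. S i j = S j i) \<and> (\<forall>c. (\<Sum>i\<in>I. \<Sum>j\<in>I. c i * S i j * c j) \<ge> 0)"

text \<open>Cholesky decomposition: split off one index at a time and pass to the Schur complement.\<close>

lemma psd_on_factorization: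
  assumes "finite I" "psd_on I S"
  shows "\<exists>L. \<forall>i\<in>I. \<forall>j\<in>I. S i j = (\<Sum>k\<in>I. L i k * L j k)"
  using assms
proof (induction I arbitrary: S rule: finite_induct)
  case (insert a I)
  note [simp] = insert.hyps
  have sym: "S i j = S j i" if "i \<in> insert a I" "j \<in> insert a I" for i j
    using insert.prems that unfolding psd_on_def by blast
  have quad: "x\<^sup>2 * S a a + 2 * x * (\<Sum>j\<in>I. c j * S a j) + (\<Sum>i\<in>I. \<Sum>j\<in>I. c i * S i j * c j) \<ge> 0" for x c
  proof -
    define d where "d = c(a := x)"
    have d: "d a = x" "\<And>i. i \<in> I \<Longrightarrow> d i = c i" using insert.hyps by (auto simp: d_def)
    have "0 \<le> (\<Sum>i\<in>insert a I. \<Sum>j\<in>insert a I. d i * S i j * d j)"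
      using insert.prems unfolding psd_on_def by blast
    also have "\<dots> = x * S a a * x + (\<Sum>j\<in>I. x * S a j * c j) + (\<Sum>i\<in>I. c i * S i a * x)
        + (\<Sum>i\<in>I. \<Sum>j\<in>I. c i * S i j * c j)"
      by (simp add: d sum.distrib cong: sum.cong)
    also have "(\<Sum>i\<in>I. c i * S i a * x) = (\<Sum>j\<in>I. x * S a j * c j)"
      by (intro sum.cong refl) (simp add: sym mult_ac)
    finally show ?thesis
      by (simp add: power2_eq_square sum_distrib_left mult_ac)
  qed
  have "S a a \<ge> 0" using quad[of 1 "\<lambda>_. 0"] by simp
  show ?case
  proof (cases "S a a = 0")
    case True
    have row: "S a j = 0" if "j \<in> I" for j
    proof (rule ccontr)
      assume "S a j \<noteq> 0"
      have "(\<Sum>i\<in>I. \<Sum>k\<in>I. of_bool (i = j) * S i k * of_bool (k = j))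
          = (\<Sum>i\<in>I. of_bool (i = j) * (\<Sum>k\<in>I. S i k * of_bool (k = j)))"
        by (simp only: sum_distrib_left mult.assoc)
      also have "\<dots> = S j j" using that by simp
      finally have diag: "(\<Sum>i\<in>I. \<Sum>k\<in>I. of_bool (i = j) * S i k * of_bool (k = j)) = S j j" .
      have row_j: "(\<Sum>k\<in>I. of_bool (k = j) * S a k) = S a j"
        using that by simp
      \<comment> \<open>With \<open>S a a = 0\<close> the form is affine in \<open>x\<close>; for
        the unit vector at \<open>j\<close> this choice of \<open>x\<close> gives
        \<open>- (S j j + 1) + S j j = -1\<close>.\<close>
      show False
        using quad[of "- (S j j + 1) / (2 * S a j)" "\<lambda>i. of_bool (i = j)"] \<open>S a j \<noteq> 0\<close> True
        unfolding diag row_j by simp argo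
    qed
    have "0 \<le> (\<Sum>i\<in>I. \<Sum>j\<in>I. c i * S i j * c j)" for c using quad[of 0 c] by simp
    then have "psd_on I S" using sym by (simp add: psd_on_def)
    then obtain L where L: "\<And>i j. i \<in> I \<Longrightarrow> j \<in> I \<Longrightarrow> S i j = (\<Sum>k\<in>I. L i k * L j k)"
      using insert.IH by blast
    define L' where "L' i k = (if i = a \<or> k = a then 0 else L i k)" for i k
    have L'_simps: "L' a k = 0" "L' i a = 0" for i k by (auto simp: L'_def)
    have L'_L: "L' i k = L i k" if "i \<in> I" "k \<in> I" for i k
      using that insert.hyps by (auto simp: L'_def)
    have "S i j = (\<Sum>k\<in>insert a I. L' i k * L' j k)" if "i \<in> insert a I" "j \<in> insert a I" for i j
    proof (cases "i = a \<or> j = a")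
      case True
      then have "S i j = 0" using row sym[OF that] that \<open>S a a = 0\<close> by auto
      moreover have "L' i k * L' j k = 0" for k using True by (auto simp: L'_simps)
      ultimately show ?thesis by (simp only: sum.neutral_const)
    next
      case False
      with that show ?thesis by (simp add: L L'_simps L'_L cong: sum.cong)
    qed
    then show ?thesis by blast
  next
    case False
    with \<open>S a a \<ge> 0\<close> have pos: "S a a > 0" by simp
    define S' where "S' i j = S i j - S a i * S a j / S a a" for i j
    have "psd_on I S'"
      unfolding psd_on_def
    proof (intro conjI ballI allI)
      show "S' i j = S' j i" if "i \<in> I" "j \<in> I" for i j
        using that sym[of i j] by (simp add: S'_def)
      fix c
      let ?b = "\<Sum>j\<in>I. c j * S a j"
      have "(\<Sum>i\<in>I. \<Sum>j\<in>I. c i * S' i j * c j)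
          = (\<Sum>i\<in>I. \<Sum>j\<in>I. c i * S i j * c j) - (\<Sum>i\<in>I. \<Sum>j\<in>I. (c i * S a i) * (c j * S a j)) / S a a"
        by (simp add: S'_def algebra_simps sum_subtractf sum_divide_distrib)
      also have "(\<Sum>i\<in>I. \<Sum>j\<in>I. (c i * S a i) * (c j * S a j)) = ?b\<^sup>2"
        by (simp add: power2_eq_square sum_product)
      finally have "(\<Sum>i\<in>I. \<Sum>j\<in>I. c i * S' i j * c j)
          = (\<Sum>i\<in>I. \<Sum>j\<in>I. c i * S i j * c j) - ?b\<^sup>2 / S a a" .
      \<comment> \<open>\<open>- ?b / S a a\<close> minimizes the form of \<open>S\<close> over the
        coordinate at \<open>a\<close>; the minimum is the form of the Schur complement.\<close>
      moreover have "(- ?b / S a a)\<^sup>2 * S a a + 2 * (- ?b / S a a) * ?b = - (?b\<^sup>2 / S a a)"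
        using pos by (simp add: power2_eq_square field_simps)
      ultimately show "0 \<le> (\<Sum>i\<in>I. \<Sum>j\<in>I. c i * S' i j * c j)"
        using quad[of "- ?b / S a a" c] by argo
    qed
    then obtain L where L: "\<And>i j. i \<in> I \<Longrightarrow> j \<in> I \<Longrightarrow> S' i j = (\<Sum>k\<in>I. L i k * L j k)"
      using insert.IH by blast
    \<comment> \<open>Column \<open>a\<close> carries the rank-one part that was split off; the
      other columns factor the Schur complement and vanish in row \<open>a\<close>.\<close>
    define L' where "L' i k = (if k = a then S a i / sqrt (S a a) else if i = a then 0 else L i k)" for i k
    have L'_simps: "L' i a = S a i / sqrt (S a a)" for i by (simp add: L'_def)
    have L'_0: "L' a k = 0" if "k \<in> I" for k using that insert.hyps by (auto simp: L'_def)
    have L'_L: "L' i k = L i k" if "i \<in> I" "k \<in> I" for i k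
      using that insert.hyps by (auto simp: L'_def)
    have eq: "S i j = (\<Sum>k\<in>insert a I. L' i k * L' j k)" if "i \<in> insert a I" "j \<in> insert a I" for i j
    proof -
      have "(\<Sum>k\<in>I. L' i k * L' j k) = (if i = a \<or> j = a then 0 else S' i j)"
        using that by (auto simp: L L'_0 L'_L cong: sum.cong)
      moreover have "L' i a * L' j a = S a i * S a j / S a a"
        using pos by (simp add: L'_simps)
      ultimately show ?thesis
        using that pos sym[OF that] by (auto simp: S'_def)
    qed
    then show ?thesis by blast
  qed
qed simp

lemma multivariate_normal_exists:
  "finite I \<Longrightarrow> psd_on I S \<Longrightarrow> \<exists>N. multivariate_normal I S N"
  using psd_on_factorization[of I S] by (auto simp: multivariate_normal_def)

lemma multivariate_normal_sets:
  "multivariate_normal I S N \<Longrightarrow> sets N = sets (\<Pi>\<^sub>M i\<in>I. borel)"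
  by (auto simp: multivariate_normal_def)

lemma multivariate_normal_prob_space:
  assumes "finite I" "multivariate_normal I S N"
  shows "prob_space N"
proof -
  interpret product_prob_space "\<lambda>_. std_normal_distribution" I
    by (rule product_prob_spaceI) (simp add: prob_space_normal_density)
  show ?thesis
    using assms(2) by (auto simp: multivariate_normal_def intro!: prob_space_distr)
qed

text \<open>A linear combination of the entries is a combination of independent standard normals
  with coefficients \<open>c\<close>, so the characteristic function factorizes. The sum of the
  squares of \<open>c\<close> is the quadratic form of \<open>S\<close>, whichever factor
  \<open>L\<close> was taken.\<close>

lemma char_multivariate_normal:
  assumes "finite I" and N: "multivariate_normal I S N"
  shows "char (distr N borel (\<lambda>z. \<Sum>i\<in>I. t i * z i)) s = exp (- (s\<^sup>2 * (\<Sum>i\<in>I. \<Sum>j\<in>I. t i * S i j * t j)) / 2)"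
proof -
  obtain L where S: "\<And>i j. i \<in> I \<Longrightarrow> j \<in> I \<Longrightarrow> S i j = (\<Sum>k\<in>I. L i k * L j k)"
    and N: "N = distr (\<Pi>\<^sub>M k\<in>I. std_normal_distribution) (\<Pi>\<^sub>M i\<in>I. borel)
              (\<lambda>z. \<lambda>i\<in>I. \<Sum>k\<in>I. L i k * z k)"
    using N by (auto simp: multivariate_normal_def)
  interpret product_prob_space "\<lambda>_. std_normal_distribution" I
    by (rule product_prob_spaceI) (simp add: prob_space_normal_density)
  interpret finite_product_sigma_finite "\<lambda>_. std_normal_distribution" I
    by standard fact
  define c where "c k = (\<Sum>i\<in>I. t i * L i k)" for k
  have lin: "(\<Sum>i\<in>I. t i * (\<Sum>k\<in>I. L i k * z k)) = (\<Sum>k\<in>I. c k * z k)" for z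
    by (simp add: c_def sum_distrib_left sum_distrib_right mult_ac) (rule sum.swap)
  have "char (distr N borel (\<lambda>z. \<Sum>i\<in>I. t i * z i)) s
      = (\<integral>z. iexp (s * (\<Sum>k\<in>I. c k * z k)) \<partial>(\<Pi>\<^sub>M k\<in>I. std_normal_distribution))"
    by (simp add: N char_def integral_distr cong: sum.cong flip: lin)
  also have "\<dots> = (\<integral>z. (\<Prod>k\<in>I. iexp (s * c k * z k)) \<partial>(\<Pi>\<^sub>M k\<in>I. std_normal_distribution))"
    using \<open>finite I\<close> by (simp add: sum_distrib_left exp_sum mult_ac)
  also have "\<dots> = (\<Prod>k\<in>I. \<integral>z. iexp (s * c k * z) \<partial>std_normal_distribution)"
    by (rule product_integral_prod[OF \<open>finite I\<close>])
       (intro finite_measure.integrable_const_bound[of _ _ 1] prob_space.finite_measure prob_space_normal_density, auto)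
  also have "\<dots> = (\<Prod>k\<in>I. exp (- (s * c k)\<^sup>2 / 2))"
    using fun_cong[OF char_std_normal_distribution, of "s * c k" for k] by (simp add: char_def)
  also have "\<dots> = exp (- (s\<^sup>2 * (\<Sum>k\<in>I. (c k)\<^sup>2)) / 2)"
    using \<open>finite I\<close>
    by (simp add: sum_distrib_left sum_divide_distrib power_mult_distrib flip: exp_sum sum_negf)
  also have "(\<Sum>k\<in>I. (c k)\<^sup>2) = (\<Sum>i\<in>I. \<Sum>j\<in>I. t i * S i j * t j)"
  proof -
    have "(\<Sum>k\<in>I. (c k)\<^sup>2) = (\<Sum>k\<in>I. \<Sum>i\<in>I. \<Sum>j\<in>I. t i * L i k * (t j * L j k))"
      by (simp add: c_def power2_eq_square sum_product)
    also have "\<dots> = (\<Sum>i\<in>I. \<Sum>j\<in>I. \<Sum>k\<in>I. t i * L i k * (t j * L j k))"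
      by (subst sum.swap) (intro sum.cong refl sum.swap)
    also have "\<dots> = (\<Sum>i\<in>I. \<Sum>j\<in>I. t i * S i j * t j)"
      by (intro sum.cong refl) (simp add: S sum_distrib_left sum_distrib_right mult_ac)
    finally show ?thesis .
  qed
  finally show ?thesis .
qed

text \<open>\<open>cramer_wold\<close> speaks about a Euclidean space, the limit law about
  extensional functions over \<open>I\<close>. Padding with zeros is the bridge, and Levy's
  continuity theorem turns convergence of characteristic functions into that of the
  projections.\<close>

lemma weak_conv_on_multivariate_normalI:
  fixes I :: "'i::finite set" and S :: "'i \<Rightarrow> 'i \<Rightarrow> real"
  assumes \<mu>: "\<And>n. prob_space (\<mu> n)" "\<And>n. sets (\<mu> n) = sets (\<Pi>\<^sub>M i\<in>I. borel)"
    and N: "multivariate_normal I S N"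
    and char: "\<And>t s. (\<lambda>n. char (distr (\<mu> n) borel (\<lambda>z. \<Sum>i\<in>I. t i * z i)) s)
      \<longlonglongrightarrow> exp (- (s\<^sup>2 * (\<Sum>i\<in>I. \<Sum>j\<in>I. t i * S i j * t j)) / 2)"
  shows "weak_conv_on I \<mu> N"
  unfolding weak_conv_on_def
proof (intro allI impI, elim conjE)
  fix f :: "('i \<Rightarrow> real) \<Rightarrow> real"
  assume f: "continuous_map (powertop_real I) euclideanreal f"
    and bd: "bounded (f ` topspace (powertop_real I))"
  note N_sets = multivariate_normal_sets[OF N]
  note N_prob = multivariate_normal_prob_space[OF _ N, simplified]
  define vec where "vec z = (\<chi> i. if i \<in> I then z i else 0)" for z :: "'i \<Rightarrow> real"
  define h where "h x = f (\<lambda>i\<in>I. x $ i)" for x :: "real^'i"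
  have vec_meas: "vec \<in> \<rho> \<rightarrow>\<^sub>M borel" if "sets \<rho> = sets (\<Pi>\<^sub>M i\<in>I. borel)" for \<rho>
  proof -
    have "vec \<in> (\<Pi>\<^sub>M i\<in>I. borel) \<rightarrow>\<^sub>M borel"
    proof (rule borel_measurable_euclidean_space[THEN iffD2], safe)
      fix b :: "real^'i" assume "b \<in> Basis"
      then obtain i where "b = axis i 1" by (auto simp: Basis_vec_def)
      then show "(\<lambda>z. vec z \<bullet> b) \<in> borel_measurable (\<Pi>\<^sub>M i\<in>I. borel)"
        by (cases "i \<in> I") (simp_all add: vec_def inner_axis)
    qed
    then show ?thesis using that by (simp cong: measurable_cong_sets)
  qed
  have h_cont: "continuous_on UNIV h"
  proof -
    have "continuous_map euclidean (powertop_real I) (\<lambda>x::real^'i. \<lambda>i\<in>I. x $ i)"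
      by (auto simp: continuous_map_componentwise intro!: continuous_intros)
    from continuous_map_compose[OF this f] show ?thesis
      by (simp add: h_def comp_def)
  qed
  obtain C where C: "\<And>x. \<bar>h x\<bar> \<le> C"
    using bd by (fastforce simp: bounded_iff h_def)
  have f_h: "integral\<^sup>L \<rho> f = integral\<^sup>L (distr \<rho> borel vec) h"
    if "sets \<rho> = sets (\<Pi>\<^sub>M i\<in>I. borel)" for \<rho>
  proof -
    have "integral\<^sup>L (distr \<rho> borel vec) h = (\<integral>z. h (vec z) \<partial>\<rho>)"
      by (rule integral_distr[OF vec_meas[OF that]]) (rule borel_measurable_continuous_onI[OF h_cont])
    also have "\<dots> = integral\<^sup>L \<rho> f"
    proof (rule Bochner_Integration.integral_cong[OF refl])
      fix z assume "z \<in> space \<rho>"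
      \<comment> \<open>The measure lives on extensional functions, so restricting the padded vector
        to \<open>I\<close> returns \<open>z\<close>.\<close>
      then have "z \<in> extensional I"
        using sets_eq_imp_space_eq[OF that] by (auto simp: space_PiM PiE_def)
      then have "(\<lambda>i\<in>I. vec z $ i) = z"
        by (auto simp: vec_def extensional_def restrict_def)
      then show "h (vec z) = f z" by (simp add: h_def)
    qed
    finally show ?thesis by simp
  qed
  have proj: "distr (distr \<rho> borel vec) borel (\<lambda>x. t \<bullet> x) = distr \<rho> borel (\<lambda>z. \<Sum>i\<in>I. t $ i * z i)"
    if "sets \<rho> = sets (\<Pi>\<^sub>M i\<in>I. borel)" for \<rho> and t :: "real^'i"
  proof -
    have "t \<bullet> vec z = (\<Sum>i\<in>I. t $ i * z i)" for z
      by (simp add: inner_vec_def vec_def if_distrib sum.If_cases cong: if_cong)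
    then show ?thesis
      using vec_meas[OF that] by (simp add: distr_distr comp_def)
  qed
  have lin_meas: "(\<lambda>z. \<Sum>i\<in>I. t i * z i) \<in> borel_measurable \<rho>"
    if "sets \<rho> = sets (\<Pi>\<^sub>M i\<in>I. borel)" for \<rho> and t :: "'i \<Rightarrow> real"
    by (subst measurable_cong_sets[OF that refl]) simp
  have "(\<lambda>n. integral\<^sup>L (distr (\<mu> n) borel vec) h) \<longlonglongrightarrow> integral\<^sup>L (distr N borel vec) h"
  proof (rule cramer_wold[OF _ _ _ _ _ h_cont C])
    show "prob_space (distr (\<mu> n) borel vec)" for n
      using \<mu>(1) vec_meas[OF \<mu>(2)] by (intro prob_space.prob_space_distr) auto
    show "prob_space (distr N borel vec)"
      using N_prob vec_meas[OF N_sets] by (intro prob_space.prob_space_distr) auto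
    show "weak_conv_m (\<lambda>n. distr (distr (\<mu> n) borel vec) borel (\<lambda>x. t \<bullet> x))
        (distr (distr N borel vec) borel (\<lambda>x. t \<bullet> x))" for t
    proof (unfold proj[OF \<mu>(2)] proj[OF N_sets], rule levy_continuity)
      show "real_distribution (distr (\<mu> n) borel (\<lambda>z. \<Sum>i\<in>I. t $ i * z i))" for n
        using \<mu>(1) lin_meas[OF \<mu>(2)] by (intro prob_space.real_distribution_distr) auto
      show "real_distribution (distr N borel (\<lambda>z. \<Sum>i\<in>I. t $ i * z i))"
        using N_prob lin_meas[OF N_sets] by (intro prob_space.real_distribution_distr) auto
      show "(\<lambda>n. char (distr (\<mu> n) borel (\<lambda>z. \<Sum>i\<in>I. t $ i * z i)) s)
          \<longlonglongrightarrow> char (distr N borel (\<lambda>z. \<Sum>i\<in>I. t $ i * z i)) s" for s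
        using char[of "\<lambda>i. t $ i" s] by (subst char_multivariate_normal[OF _ N]) auto
    qed
  qed auto
  then show "(\<lambda>n. integral\<^sup>L (\<mu> n) f) \<longlonglongrightarrow> integral\<^sup>L N f"
    by (simp add: f_h[OF \<mu>(2)] f_h[OF N_sets])
qed

section \<open>Residuals and instruments as linear forms in the observation\<close>

lemma bounded_linear_residual: "bounded_linear (residual D b v)"
  unfolding residual_def
  by (intro bounded_linear_sub bounded_linear_sum bounded_linear_const_mult bounded_linear_vec_nth)

lemma bounded_linear_instrument: "bounded_linear (instrument D B b v y)"
  unfolding instrument_def
  by (cases "y \<in> htr D B v") (auto intro: bounded_linear_residual bounded_linear_vec_nth)

subsection \<open>The reduced form of the model\<close>

lemma matrix_inv_mult_left:
  fixes A :: "real^'n^'n"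
  assumes "det A \<noteq> 0"
  shows "matrix_inv A ** A = mat 1"
proof -
  have "\<exists>A'. A ** A' = mat 1 \<and> A' ** A = mat 1"
    using assms by (simp add: invertible_det_nz[symmetric] invertible_def)
  then show ?thesis unfolding matrix_inv_def by (rule someI2_ex) simp
qed

lemma transpose_mult_nth: "(transpose A *v x) $ i = (\<Sum>k\<in>UNIV. A $ k $ i * x $ k)"
  by (simp only: matrix_vector_mult_def transpose_def vec_lambda_beta)

text \<open>As \<open>\<beta>\<close> vanishes off the edges, the residuals are the entries of
  \<open>transpose (mat 1 - \<beta>)\<close> applied to the observation, which undoes the reduced
  form. Moments under the model thereby become moments of the errors.\<close>

lemma residual_reduced_form:
  assumes "\<beta> \<in> coefficient_matrices D"
  shows "residual D \<beta> v (transpose (matrix_inv (mat 1 - \<beta>)) *v e) = e $ v"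
proof -
  let ?N = "matrix_inv (mat 1 - \<beta>)"
  have zero: "\<beta> $ w $ v = 0" if "w \<notin> pa D v" for w
    using assms that by (auto simp: coefficient_matrices_def pa_def)
  have "?N ** (mat 1 - \<beta>) = mat 1"
    using assms by (intro matrix_inv_mult_left) (simp add: coefficient_matrices_def)
  then have "transpose (mat 1 - \<beta>) ** transpose ?N = mat 1"
    by (simp flip: matrix_transpose_mul add: transpose_mat)
  then have "transpose (mat 1 - \<beta>) *v (transpose ?N *v e) = e"
    by (simp add: matrix_vector_mul_assoc del: transpose_matrix_vector)
  moreover have "(transpose (mat 1 - \<beta>) *v x) $ v = residual D \<beta> v x" for x
  proof -
    have "(\<Sum>w\<in>UNIV. \<beta> $ w $ v * x $ w) = (\<Sum>w\<in>pa D v. \<beta> $ w $ v * x $ w)"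
      by (intro sum.mono_neutral_right) (auto simp: zero)
    then show ?thesis
      by (simp add: residual_def transpose_mult_nth mat_def left_diff_distrib
          sum_subtractf if_distrib[of "\<lambda>y. y * _"] sum.delta cong: if_cong del: transpose_matrix_vector)
  qed
  ultimately show ?thesis by metis
qed

text \<open>\<open>I - \<beta>\<close> maps the vectors supported on the ancestors of \<open>y\<close> injectively into themselves, hence
  onto themselves. This replaces the Neumann series, which need not converge in a cyclic graph.\<close>

lemma reduced_form_no_path:
  fixes \<beta> :: "real^'v::finite^'v"
  assumes \<beta>: "\<beta> \<in> coefficient_matrices D" and no_path: "(w, y) \<notin> D\<^sup>*"
  shows "matrix_inv (mat 1 - \<beta>) $ w $ y = 0"
proof -
  let ?M = "mat 1 - \<beta>"
  have inv: "matrix_inv ?M ** ?M = mat 1"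
    using \<beta> by (intro matrix_inv_mult_left) (simp add: coefficient_matrices_def)
  define V :: "(real^'v) set" where "V = {x. \<forall>u. (u, y) \<notin> D\<^sup>* \<longrightarrow> x $ u = 0}"
  have "subspace V" by (auto simp: V_def subspace_def)
  have "?M *v x \<in> V" if "x \<in> V" for x
  proof -
    have "(?M *v x) $ u = 0" if u: "(u, y) \<notin> D\<^sup>*" for u
    proof -
      have "\<beta> $ u $ k * x $ k = 0" for k
      proof (cases "(u, k) \<in> D")
        case True
        then have "(k, y) \<notin> D\<^sup>*" using u by (meson converse_rtrancl_into_rtrancl)
        then show ?thesis using \<open>x \<in> V\<close> by (simp add: V_def)
      next
        case False
        then show ?thesis using \<beta> by (simp add: coefficient_matrices_def)
      qed
      then have "(\<beta> *v x) $ u = 0" by (simp only: matrix_vector_mult_def vec_lambda_beta sum.neutral_const)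
      then show ?thesis
        using \<open>x \<in> V\<close> u by (simp add: matrix_vector_mult_diff_rdistrib V_def)
    qed
    then show ?thesis by (simp add: V_def)
  qed
  then have "(*v) ?M ` V \<subseteq> V" by auto
  moreover have "inj ((*v) ?M)"
    using inv matrix_left_invertible_injective by blast
  then have "dim ((*v) ?M ` V) = dim V"
    by (intro dim_image_eq) (auto intro: inj_on_subset)
  ultimately have "(*v) ?M ` V = V"
    using \<open>subspace V\<close> by (intro subspace_dim_equal) (auto intro: linear_subspace_image)
  \<comment> \<open>The vertex \<open>y\<close> is its own ancestor, so the unit vector has a
    preimage in \<open>V\<close>; this preimage is column \<open>y\<close> of the inverse.\<close>
  moreover have "axis y 1 \<in> V" by (auto simp: V_def axis_def)
  ultimately obtain x where x: "x \<in> V" "?M *v x = axis y 1" by (metis imageE)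
  have "matrix_inv ?M *v axis y 1 = x"
    by (simp add: x(2)[symmetric] matrix_vector_mul_assoc inv)
  then have "matrix_inv ?M $ w $ y = x $ w"
    by (simp add: matrix_vector_mult_basis column_def vec_eq_iff)
  then show ?thesis using x(1) no_path by (simp add: V_def)
qed

lemma directed_path_successively:
  "(w, y) \<in> D\<^sup>* \<Longrightarrow> \<exists>vs. successively (\<lambda>a b. (a, b) \<in> D) (w # vs) \<and> last (w # vs) = y"
proof (induction rule: converse_rtrancl_induct)
  case base
  show ?case by (rule exI[of _ "[]"]) simp
next
  case (step u w)
  then obtain vs where "successively (\<lambda>a b. (a, b) \<in> D) (w # vs)" "last (w # vs) = y" by blast
  with step(1) show ?case by (intro exI[of _ "w # vs"]) auto
qed

text \<open>A directed path from \<open>v\<close> is itself a half-trek; one from a sibling becomes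
  a half-trek by prefixing the bidirected edge. It is used contrapositively, to exclude such
  paths.\<close>

lemma htrI:
  assumes "w \<in> {v} \<union> sib B v" "(w, y) \<in> D\<^sup>*" "y \<notin> {v} \<union> sib B v"
  shows "y \<in> htr D B v"
proof -
  obtain vs where vs: "successively (\<lambda>a b. (a, b) \<in> D) (w # vs)" "last (w # vs) = y"
    using directed_path_successively[OF assms(2)] by blast
  define \<pi> where "\<pi> = (if w = v then Half_Trek False v vs else Half_Trek True v (w # vs))"
  have "is_half_trek D B \<pi>" "source \<pi> = v" "target \<pi> = y"
    using assms(1) vs by (auto simp: \<pi>_def target_def sib_def insert_commute)
  then show ?thesis using assms(3) by (auto simp: htr_def)
qed

subsection \<open>Moments\<close>

lemma borel_measurable_vec_nth [measurable (raw)]: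
  fixes f :: "'a \<Rightarrow> real^'v::finite"
  assumes "f \<in> borel_measurable M" shows "(\<lambda>x. f x $ i) \<in> borel_measurable M"
  by (rule measurable_compose[OF assms])
     (intro borel_measurable_continuous_onI linear_continuous_on bounded_linear_vec_nth)

text \<open>The class in which the recursion for \<open>R\<close> and \<open>phi\<close> stays: it
  contains products of two linear forms, is closed under linear combinations, and two members have
  an integrable product under a fourth moment.\<close>

definition quad_bounded :: "(real^'v::finite \<Rightarrow> real) \<Rightarrow> bool" where
  "quad_bounded f \<longleftrightarrow> f \<in> borel_measurable borel \<and> (\<exists>C. \<forall>x. \<bar>f x\<bar> \<le> C * (norm x)\<^sup>2)"

lemma quad_bounded_measurable: "quad_bounded f \<Longrightarrow> f \<in> borel_measurable borel"
  by (simp add: quad_bounded_def)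

lemma quad_bounded_mult_linear:
  assumes "bounded_linear f" "bounded_linear g"
  shows "quad_bounded (\<lambda>x. f x * g x)"
proof -
  obtain K where K: "\<And>x. norm (f x) \<le> norm x * K" "K \<ge> 0"
    using bounded_linear.nonneg_bounded[OF assms(1)] by blast
  obtain L where L: "\<And>x. norm (g x) \<le> norm x * L" "L \<ge> 0"
    using bounded_linear.nonneg_bounded[OF assms(2)] by blast
  have "\<bar>f x * g x\<bar> \<le> (K * L) * (norm x)\<^sup>2" for x
  proof -
    have "\<bar>f x\<bar> * \<bar>g x\<bar> \<le> (norm x * K) * (norm x * L)"
      using K L by (intro mult_mono) auto
    then show ?thesis by (simp add: abs_mult power2_eq_square mult_ac)
  qed
  moreover have "f \<in> borel_measurable borel" "g \<in> borel_measurable borel"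
    using assms by (auto intro!: borel_measurable_continuous_onI linear_continuous_on)
  ultimately show ?thesis unfolding quad_bounded_def by auto
qed

lemma quad_bounded_cmult:
  assumes "quad_bounded f" shows "quad_bounded (\<lambda>x. c * f x)"
proof -
  obtain C where "\<And>x. \<bar>f x\<bar> \<le> C * (norm x)\<^sup>2" using assms by (auto simp: quad_bounded_def)
  then have "\<bar>c * f x\<bar> \<le> (\<bar>c\<bar> * C) * (norm x)\<^sup>2" for x
    by (simp add: abs_mult mult.assoc mult_left_mono)
  then show ?thesis using assms unfolding quad_bounded_def by auto
qed

lemma quad_bounded_add:
  assumes "quad_bounded f" "quad_bounded g" shows "quad_bounded (\<lambda>x. f x + g x)"
proof -
  obtain C K where *: "\<And>x. \<bar>f x\<bar> \<le> C * (norm x)\<^sup>2" "\<And>x. \<bar>g x\<bar> \<le> K * (norm x)\<^sup>2"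
    using assms by (auto simp: quad_bounded_def)
  have "\<bar>f x + g x\<bar> \<le> (C + K) * (norm x)\<^sup>2" for x
    using *(1)[of x] *(2)[of x] abs_triangle_ineq[of "f x" "g x"] by (simp add: distrib_right)
  then show ?thesis using assms unfolding quad_bounded_def by auto
qed

lemma quad_bounded_diff:
  "quad_bounded f \<Longrightarrow> quad_bounded g \<Longrightarrow> quad_bounded (\<lambda>x. f x - g x)"
  using quad_bounded_add[of f "\<lambda>x. (-1) * g x"] quad_bounded_cmult[of g "-1"] by simp

lemma quad_bounded_sum:
  "(\<And>i. i \<in> I \<Longrightarrow> quad_bounded (f i)) \<Longrightarrow> quad_bounded (\<lambda>x. \<Sum>i\<in>I. f i x)"
proof (induction I rule: infinite_finite_induct)
  case (insert i I)
  then show ?case by (auto intro: quad_bounded_add)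
qed (auto simp: quad_bounded_def intro!: exI[of _ 0])

locale fourth_moment = prob_space P for P :: "(real^'v::finite) measure" +
  assumes sets_borel [measurable_cong]: "sets P = sets borel"
    and fourth_moment: "integrable P (\<lambda>x. norm x ^ 4)"
begin

lemma integrable_mult_quad:
  assumes f: "quad_bounded f" and g: "quad_bounded g"
  shows "integrable P (\<lambda>x. f x * g x)"
proof -
  obtain C K where C: "\<And>x. \<bar>f x\<bar> \<le> C * (norm x)\<^sup>2" and K: "\<And>x. \<bar>g x\<bar> \<le> K * (norm x)\<^sup>2"
    using f g by (auto simp: quad_bounded_def)
  have [measurable]: "f \<in> borel_measurable borel" "g \<in> borel_measurable borel"
    using f g by (auto simp: quad_bounded_def)
  have "\<bar>f x * g x\<bar> \<le> (C * K) * norm x ^ 4" for x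
  proof -
    have "\<bar>f x\<bar> * \<bar>g x\<bar> \<le> (C * (norm x)\<^sup>2) * (K * (norm x)\<^sup>2)"
      using C[of x] K[of x] by (intro mult_mono) (auto intro: order_trans[OF abs_ge_zero])
    also have "\<dots> = (C * K) * norm x ^ 4" by (simp add: power2_eq_square power4_eq_xxxx mult_ac)
    finally show ?thesis by (simp add: abs_mult)
  qed
  then show ?thesis
    by (intro Bochner_Integration.integrable_bound[OF integrable_mult_right[OF fourth_moment, of "C * K"]])
       (auto intro!: AE_I2 order_trans[OF _ abs_ge_self])
qed

lemma integrable_quad: "quad_bounded f \<Longrightarrow> integrable P f"
proof (rule square_integrable_imp_integrable)
  assume f: "quad_bounded f"
  then show "f \<in> borel_measurable P"
    by (simp add: quad_bounded_def measurable_cong_sets[OF sets_borel refl])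
  show "integrable P (\<lambda>x. (f x)\<^sup>2)"
    using integrable_mult_quad[OF f f] by (simp only: power2_eq_square)
qed

end

lemma norm_power4_le:
  fixes x :: "real^'v::finite"
  shows "norm x ^ 4 \<le> real CARD('v) * (\<Sum>v\<in>UNIV. (x $ v) ^ 4)"
proof -
  have "norm x ^ 4 = (\<Sum>v\<in>UNIV. (x $ v)\<^sup>2)\<^sup>2"
    by (simp add: norm_vec_def L2_set_def sum_nonneg power4_eq_xxxx power2_eq_square)
  also have "\<dots> \<le> (\<Sum>v\<in>UNIV. ((x $ v)\<^sup>2)\<^sup>2) * real CARD('v)"
    by (rule sum_squared_le_sum_of_squares)
  finally show ?thesis by (simp add: mult.commute flip: power_mult)
qed

lemma fourth_moment_model_dist:
  assumes "error_vector B \<Omega> \<epsilon>"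
  shows "fourth_moment (model_dist \<beta> \<Omega> \<epsilon>)"
proof -
  interpret \<Omega>: prob_space \<Omega> using assms by (simp add: error_vector_def)
  let ?X = "\<lambda>\<omega>. transpose (matrix_inv (mat 1 - \<beta>)) *v \<epsilon> \<omega>"
  have [measurable]: "\<epsilon> \<in> borel_measurable \<Omega>" using assms by (simp add: error_vector_def)
  have lin: "bounded_linear ((*v) (transpose (matrix_inv (mat 1 - \<beta>))))"
    by (rule matrix_vector_mul_bounded_linear)
  have [measurable]: "(*v) (transpose (matrix_inv (mat 1 - \<beta>))) \<in> borel_measurable borel"
    by (intro borel_measurable_continuous_onI linear_continuous_on lin)
  obtain K where K: "\<And>e. norm (transpose (matrix_inv (mat 1 - \<beta>)) *v e) \<le> norm e * K" "K \<ge> 0"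
    using bounded_linear.nonneg_bounded[OF lin] by blast
  have "integrable \<Omega> (\<lambda>\<omega>. K ^ 4 * (real CARD('a) * (\<Sum>v\<in>UNIV. (\<epsilon> \<omega> $ v) ^ 4)))"
    using assms by (auto simp: error_vector_def)
  then have "integrable \<Omega> (\<lambda>\<omega>. norm (?X \<omega>) ^ 4)"
  proof (rule Bochner_Integration.integrable_bound)
    have "norm (?X \<omega>) ^ 4 \<le> K ^ 4 * (real CARD('a) * (\<Sum>v\<in>UNIV. (\<epsilon> \<omega> $ v) ^ 4))" for \<omega>
    proof -
      have "norm (?X \<omega>) ^ 4 \<le> (norm (\<epsilon> \<omega>) * K) ^ 4" by (intro power_mono K) simp
      also have "\<dots> = K ^ 4 * norm (\<epsilon> \<omega>) ^ 4" by (simp add: power_mult_distrib)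
      also have "\<dots> \<le> K ^ 4 * (real CARD('a) * (\<Sum>v\<in>UNIV. (\<epsilon> \<omega> $ v) ^ 4))"
        by (intro mult_left_mono norm_power4_le) (simp add: K)
      finally show ?thesis .
    qed
    then show "AE \<omega> in \<Omega>. norm (norm (?X \<omega>) ^ 4) \<le> norm (K ^ 4 * (real CARD('a) * (\<Sum>v\<in>UNIV. (\<epsilon> \<omega> $ v) ^ 4)))"
      by (auto intro!: AE_I2 order_trans[OF _ abs_ge_self])
  qed measurable
  then show ?thesis
    unfolding model_dist_def fourth_moment_def fourth_moment_axioms_def
    by (auto simp: integrable_distr_eq simp del: transpose_matrix_vector intro!: \<Omega>.prob_space_distr)
qed

text \<open>A singleton is connected in the bidirected graph, so the error at \<open>v\<close> is
  independent of the errors outside \<open>v\<close> and its siblings; mean zero then makes them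
  uncorrelated.\<close>

lemma error_products:
  assumes err: "error_vector B \<Omega> \<epsilon>"
  shows "integrable \<Omega> (\<lambda>\<omega>. \<epsilon> \<omega> $ w * \<epsilon> \<omega> $ v)"
    and "w \<notin> {v} \<union> sib B v \<Longrightarrow> (\<integral>\<omega>. \<epsilon> \<omega> $ w * \<epsilon> \<omega> $ v \<partial>\<Omega>) = 0"
proof -
  interpret \<Omega>: prob_space \<Omega> using err by (simp add: error_vector_def)
  have [measurable]: "\<epsilon> \<in> borel_measurable \<Omega>" using err by (simp add: error_vector_def)
  have mean: "(\<integral>\<omega>. \<epsilon> \<omega> $ v \<partial>\<Omega>) = 0" for v using err by (simp add: error_vector_def)
  have 4: "integrable \<Omega> (\<lambda>\<omega>. (\<epsilon> \<omega> $ v) ^ 4)" for v using err by (simp add: error_vector_def)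
  have 2: "integrable \<Omega> (\<lambda>\<omega>. (\<epsilon> \<omega> $ v)\<^sup>2)" for v
  proof (rule \<Omega>.square_integrable_imp_integrable)
    show "integrable \<Omega> (\<lambda>\<omega>. ((\<epsilon> \<omega> $ v)\<^sup>2)\<^sup>2)"
      using 4[of v] by (simp only: power2_eq_square power4_eq_xxxx mult.assoc)
  qed simp
  have 1: "integrable \<Omega> (\<lambda>\<omega>. \<epsilon> \<omega> $ v)" for v
    by (rule \<Omega>.square_integrable_imp_integrable[OF _ 2]) simp
  show "integrable \<Omega> (\<lambda>\<omega>. \<epsilon> \<omega> $ w * \<epsilon> \<omega> $ v)"
  proof (rule Bochner_Integration.integrable_bound)
    show "integrable \<Omega> (\<lambda>\<omega>. (\<epsilon> \<omega> $ w)\<^sup>2 + (\<epsilon> \<omega> $ v)\<^sup>2)" using 2 by simp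
    have "\<bar>a * b\<bar> \<le> a\<^sup>2 + b\<^sup>2" for a b :: real
    proof -
      have "0 \<le> \<bar>a\<bar> * \<bar>b\<bar>" by simp
      then show ?thesis
        using sum_squares_bound[of "\<bar>a\<bar>" "\<bar>b\<bar>"] unfolding abs_mult power2_abs by linarith
    qed
    then show "AE \<omega> in \<Omega>. norm (\<epsilon> \<omega> $ w * \<epsilon> \<omega> $ v) \<le> norm ((\<epsilon> \<omega> $ w)\<^sup>2 + (\<epsilon> \<omega> $ v)\<^sup>2)"
      by (auto intro!: AE_I2)
  qed measurable
  assume w: "w \<notin> {v} \<union> sib B v"
  define U where "U = - ({v} \<union> sib_set B {v})"
  have "w \<in> U" using w by (auto simp: U_def sib_set_def sib_def)
  have "bidir_connected B {v}" by (simp add: bidir_connected_def)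
  then have "\<Omega>.indep_var (\<Pi>\<^sub>M u\<in>{v}. borel) (\<lambda>\<omega>. \<lambda>u\<in>{v}. \<epsilon> \<omega> $ u) (\<Pi>\<^sub>M u\<in>U. borel) (\<lambda>\<omega>. \<lambda>u\<in>U. \<epsilon> \<omega> $ u)"
    using err unfolding error_vector_def U_def by blast
  then have "\<Omega>.indep_var borel ((\<lambda>f. f v) \<circ> (\<lambda>\<omega>. \<lambda>u\<in>{v}. \<epsilon> \<omega> $ u)) borel ((\<lambda>f. f w) \<circ> (\<lambda>\<omega>. \<lambda>u\<in>U. \<epsilon> \<omega> $ u))"
    using \<open>w \<in> U\<close> by (intro \<Omega>.indep_var_compose) auto
  then have "\<Omega>.indep_var borel (\<lambda>\<omega>. \<epsilon> \<omega> $ v) borel (\<lambda>\<omega>. \<epsilon> \<omega> $ w)"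
    using \<open>w \<in> U\<close> by (simp add: comp_def)
  from \<Omega>.indep_var_lebesgue_integral[OF this 1 1]
  show "(\<integral>\<omega>. \<epsilon> \<omega> $ w * \<epsilon> \<omega> $ v \<partial>\<Omega>) = 0"
    by (simp add: mean mult.commute[of "\<epsilon> _ $ w"])
qed

lemma instrument_exogenous:
  assumes \<beta>: "\<beta> \<in> coefficient_matrices D" and err: "error_vector B \<Omega> \<epsilon>"
    and htc: "satisfies_htc D B v Y" and y: "y \<in> Y"
  shows "(\<integral>x. instrument D B \<beta> v y x * residual D \<beta> v x \<partial>model_dist \<beta> \<Omega> \<epsilon>) = 0"
proof -
  let ?N = "matrix_inv (mat 1 - \<beta>)"
  have [measurable]: "\<epsilon> \<in> borel_measurable \<Omega>" using err by (simp add: error_vector_def)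
  have [measurable]: "(*v) (transpose ?N) \<in> borel_measurable borel"
    by (intro borel_measurable_continuous_onI linear_continuous_on matrix_vector_mul_bounded_linear)
  have [measurable]: "instrument D B \<beta> v y \<in> borel_measurable borel" "residual D \<beta> v \<in> borel_measurable borel"
    by (auto intro!: borel_measurable_continuous_onI linear_continuous_on
        bounded_linear_instrument bounded_linear_residual)
  have y': "y \<notin> {v} \<union> sib B v" using htc y by (auto simp: satisfies_htc_def)
  have "(\<integral>x. instrument D B \<beta> v y x * residual D \<beta> v x \<partial>model_dist \<beta> \<Omega> \<epsilon>)
      = (\<integral>\<omega>. instrument D B \<beta> v y (transpose ?N *v \<epsilon> \<omega>) * \<epsilon> \<omega> $ v \<partial>\<Omega>)"
    by (simp add: model_dist_def integral_distr residual_reduced_form[OF \<beta>] del: transpose_matrix_vector)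
  also have "\<dots> = 0"
  proof (cases "y \<in> htr D B v")
    case True
    then show ?thesis
      using error_products(2)[OF err y'] by (simp add: instrument_def residual_reduced_form[OF \<beta>] del: transpose_matrix_vector)
  next
    case False
    \<comment> \<open>Each term vanishes for one of two reasons: \<open>w\<close> is neither
      \<open>v\<close> nor a sibling and the errors are uncorrelated, or it is and no directed path
      leads from \<open>w\<close> to \<open>y\<close>, so the coefficient is 0.\<close>
    have "?N $ w $ y * (\<integral>\<omega>. \<epsilon> \<omega> $ w * \<epsilon> \<omega> $ v \<partial>\<Omega>) = 0" for w
      using reduced_form_no_path[OF \<beta>, of w y] htrI[of w v B y D] y' False
        error_products(2)[OF err, of w v] by fastforce
    moreover have "(\<integral>\<omega>. (transpose ?N *v \<epsilon> \<omega>) $ y * \<epsilon> \<omega> $ v \<partial>\<Omega>)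
        = (\<Sum>w\<in>UNIV. ?N $ w $ y * (\<integral>\<omega>. \<epsilon> \<omega> $ w * \<epsilon> \<omega> $ v \<partial>\<Omega>))"
      by (simp add: transpose_mult_nth sum_distrib_right mult.assoc
          Bochner_Integration.integral_sum error_products(1)[OF err] del: transpose_matrix_vector)
    ultimately show ?thesis
      using False by (simp only: instrument_def if_False sum.neutral_const)
  qed
  finally show ?thesis .
qed

subsection \<open>Perturbed linear systems\<close>

lemma inverse_on_inv_on: "invertible_on I J A \<Longrightarrow> inverse_on I J A (inv_on I J A)"
  using someI_ex[of "inverse_on I J A"] by (auto simp: invertible_on_def inv_on_def)

lemma inverse_onD:
  assumes "inverse_on I J A C"
  shows "i \<in> I \<Longrightarrow> i' \<in> I \<Longrightarrow> (\<Sum>j\<in>J. A i j * C j i') = of_bool (i = i')"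
    and "j \<in> J \<Longrightarrow> j' \<in> J \<Longrightarrow> (\<Sum>i\<in>I. C j i * A i j') = of_bool (j = j')"
  using assms by (auto simp: inverse_on_def)

text \<open>If \<open>C\<close> inverts \<open>A\<close> and \<open>A'\<close> is close to \<open>A\<close>, then \<open>1 + C (A' - A)\<close> has an inverse \<open>F\<close>, since its
  determinant is close to 1, and \<open>F C\<close> inverts \<open>A'\<close>.\<close>

lemma eventually_invertible_on:
  fixes J :: "'j::finite set"
  assumes "finite I" and inv: "inverse_on I J A C"
    and conv: "\<And>i j. i \<in> I \<Longrightarrow> j \<in> J \<Longrightarrow> ((\<lambda>z. A' z i j) \<longlongrightarrow> A i j) F"
  shows "eventually (\<lambda>z. invertible_on I J (A' z)) F"
proof -
  \<comment> \<open>The matrix \<open>1 + C (A' - A)\<close>, extended by the identity off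
    \<open>J\<close> so that determinants over the whole type apply; the zero off-diagonal blocks
    let sums be restricted to \<open>J\<close> again.\<close>
  define T where "T z = (\<chi> j k. of_bool (j = k) +
      (if j \<in> J \<and> k \<in> J then \<Sum>i\<in>I. C j i * (A' z i k - A i k) else 0))" for z
  have T_lim: "((\<lambda>z. T z $ j $ k) \<longlongrightarrow> (mat 1 :: real^'j^'j) $ j $ k) F" for j k
  proof (cases "j \<in> J \<and> k \<in> J")
    case True
    have "((\<lambda>z. of_bool (j = k) + (\<Sum>i\<in>I. C j i * (A' z i k - A i k)))
        \<longlongrightarrow> of_bool (j = k) + (\<Sum>i\<in>I. C j i * (A i k - A i k))) F"
      using True by (intro tendsto_intros conv) auto
    then show ?thesis using True by (simp add: T_def mat_def of_bool_def)
  next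
    case False
    then show ?thesis by (auto simp: T_def mat_def)
  qed
  have "((\<lambda>z. det (T z)) \<longlongrightarrow> det (mat 1 :: real^'j^'j)) F"
    unfolding det_def by (intro tendsto_sum tendsto_mult tendsto_const tendsto_prod T_lim)
  then have "eventually (\<lambda>z. det (T z) \<noteq> 0) F"
    by (rule tendsto_imp_eventually_ne) simp
  then show ?thesis
  proof eventually_elim
    case (elim z)
    then obtain G where "T z ** G = mat 1" "G ** T z = mat 1"
      by (auto simp: invertible_det_nz[symmetric] invertible_def)
    then have TG: "(\<Sum>k\<in>UNIV. T z $ j $ k * G $ k $ j') = of_bool (j = j')"
      and GT: "(\<Sum>k\<in>UNIV. G $ j $ k * T z $ k $ j') = of_bool (j = j')" for j j'
      by (simp_all add: matrix_matrix_mult_def vec_eq_iff mat_def of_bool_def)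
    have TG_J: "(\<Sum>k\<in>J. T z $ j $ k * G $ k $ j') = of_bool (j = j')" if "j \<in> J" for j j'
      unfolding TG[symmetric] using that by (intro sum.mono_neutral_left) (auto simp: T_def)
    have GT_J: "(\<Sum>k\<in>J. G $ j $ k * T z $ k $ j') = of_bool (j = j')" if "j' \<in> J" for j j'
      unfolding GT[symmetric] using that by (intro sum.mono_neutral_left) (auto simp: T_def)
    \<comment> \<open>From \<open>C A = 1\<close> comes \<open>T = C A'\<close>, and from
      \<open>A C = 1\<close> then \<open>A T = A'\<close>; with \<open>G\<close> inverse to
      \<open>T\<close> this makes \<open>G C\<close> a two-sided inverse of
      \<open>A'\<close>.\<close>
    have CA: "(\<Sum>i\<in>I. C j i * A' z i k) = T z $ j $ k" if "j \<in> J" "k \<in> J" for j k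
      using that inverse_onD(2)[OF inv that]
      by (simp add: T_def right_diff_distrib sum_subtractf)
    have AT: "(\<Sum>j\<in>J. A i j * T z $ j $ k) = A' z i k" if "i \<in> I" "k \<in> J" for i k
    proof -
      have "(\<Sum>j\<in>J. A i j * T z $ j $ k) = (\<Sum>j\<in>J. \<Sum>l\<in>I. A i j * C j l * A' z l k)"
        using that by (simp add: CA[symmetric] sum_distrib_left mult.assoc)
      also have "\<dots> = (\<Sum>l\<in>I. (\<Sum>j\<in>J. A i j * C j l) * A' z l k)"
        by (subst sum.swap) (simp add: sum_distrib_right)
      also have "\<dots> = A' z i k"
        using that \<open>finite I\<close> by (simp add: inverse_onD(1)[OF inv] cong: sum.cong)
      finally show ?thesis .
    qed
    have "inverse_on I J (A' z) (\<lambda>j i. \<Sum>k\<in>J. G $ j $ k * C k i)"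
      unfolding inverse_on_def
    proof (intro conjI ballI)
      fix i i' assume i: "i \<in> I" "i' \<in> I"
      have "(\<Sum>j\<in>J. A' z i j * (\<Sum>k\<in>J. G $ j $ k * C k i'))
          = (\<Sum>j\<in>J. \<Sum>k\<in>J. \<Sum>l\<in>J. A i l * (T z $ l $ j * G $ j $ k) * C k i')"
        using i by (simp add: AT[symmetric] sum_distrib_left sum_distrib_right mult.assoc)
      also have "\<dots> = (\<Sum>k\<in>J. \<Sum>l\<in>J. A i l * (\<Sum>j\<in>J. T z $ l $ j * G $ j $ k) * C k i')"
        unfolding sum_distrib_left sum_distrib_right
        by (subst sum.swap) (intro sum.cong refl sum.swap)
      also have "\<dots> = (\<Sum>k\<in>J. A i k * C k i')"
        by (intro sum.cong refl) (simp add: TG_J flip: sum_distrib_right cong: sum.cong)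
      also have "\<dots> = (if i = i' then 1 else 0)"
        using inverse_onD(1)[OF inv i] by (simp add: of_bool_def)
      finally show "(\<Sum>j\<in>J. A' z i j * (\<Sum>k\<in>J. G $ j $ k * C k i')) = (if i = i' then 1 else 0)" .
    next
      fix j j' assume j: "j \<in> J" "j' \<in> J"
      have "(\<Sum>i\<in>I. (\<Sum>k\<in>J. G $ j $ k * C k i) * A' z i j')
          = (\<Sum>k\<in>J. G $ j $ k * (\<Sum>i\<in>I. C k i * A' z i j'))"
        unfolding sum_distrib_left sum_distrib_right by (subst sum.swap) (simp add: mult.assoc)
      also have "\<dots> = (\<Sum>k\<in>J. G $ j $ k * T z $ k $ j')"
        using j by (simp add: CA)
      finally show "(\<Sum>i\<in>I. (\<Sum>k\<in>J. G $ j $ k * C k i) * A' z i j') = (if j = j' then 1 else 0)"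
        using GT_J[OF j(2), of j] by (simp add: of_bool_def)
    qed
    then show ?case by (auto simp: invertible_on_def)
  qed
qed

text \<open>The solution satisfies \<open>\<delta> = C G - H \<delta>\<close> with \<open>H = C (A' - A)\<close> vanishing in the limit, which gives first
  the tightness of \<open>\<delta>\<close> and then the expansion.\<close>

lemma linear_system_expansion:
  assumes "finite I" "finite J" and inv: "inverse_on I J A C"
    and conv: "\<And>i j. i \<in> I \<Longrightarrow> j \<in> J \<Longrightarrow> ((\<lambda>z. A' z i j) \<longlongrightarrow> A i j) F"
    and tight: "\<And>i. i \<in> I \<Longrightarrow> tight_along F (G i)"
    and system: "eventually (\<lambda>z. \<forall>i\<in>I. (\<Sum>j\<in>J. A' z i j * \<delta> j z) = G i z) F"
    and "j \<in> J"
  shows "((\<lambda>z. \<delta> j z - (\<Sum>i\<in>I. C j i * G i z)) \<longlongrightarrow> 0) F"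
proof -
  define H where "H z j k = (\<Sum>i\<in>I. C j i * (A' z i k - A i k))" for z j k
  have H: "((\<lambda>z. H z j k) \<longlongrightarrow> 0) F" if "k \<in> J" for j k
  proof -
    have "((\<lambda>z. H z j k) \<longlongrightarrow> (\<Sum>i\<in>I. C j i * (A i k - A i k))) F"
      unfolding H_def using that by (intro tendsto_intros conv) auto
    then show ?thesis by simp
  qed
  have eq: "eventually (\<lambda>z. \<forall>j\<in>J. \<delta> j z = (\<Sum>i\<in>I. C j i * G i z) - (\<Sum>k\<in>J. H z j k * \<delta> k z)) F"
    using system
  proof (eventually_elim, intro ballI)
    fix z j assume *: "\<forall>i\<in>I. (\<Sum>j\<in>J. A' z i j * \<delta> j z) = G i z" and "j \<in> J"
    have "(\<Sum>i\<in>I. C j i * G i z) = (\<Sum>i\<in>I. \<Sum>k\<in>J. C j i * A' z i k * \<delta> k z)"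
      using * by (simp add: sum_distrib_left mult.assoc flip: *[rule_format] cong: sum.cong)
    also have "\<dots> = (\<Sum>k\<in>J. (\<Sum>i\<in>I. C j i * A' z i k) * \<delta> k z)"
      by (subst sum.swap) (simp add: sum_distrib_right)
    also have "\<dots> = (\<Sum>k\<in>J. (of_bool (j = k) + H z j k) * \<delta> k z)"
      using \<open>j \<in> J\<close> by (intro sum.cong refl)
        (simp add: H_def right_diff_distrib sum_subtractf inverse_onD(2)[OF inv])
    also have "\<dots> = \<delta> j z + (\<Sum>k\<in>J. H z j k * \<delta> k z)"
      using \<open>finite J\<close> \<open>j \<in> J\<close> by (simp add: distrib_right sum.distrib)
    finally show "\<delta> j z = (\<Sum>i\<in>I. C j i * G i z) - (\<Sum>k\<in>J. H z j k * \<delta> k z)" by simp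
  qed
  \<comment> \<open>The equation yields \<open>s \<le> g + h * s\<close>; once
    \<open>h < 1 / 2\<close> this gives \<open>s \<le> 2 * g\<close>, so tightness passes from
    \<open>G\<close> to the solution.\<close>
  define g where "g z = (\<Sum>j\<in>J. \<bar>\<Sum>i\<in>I. C j i * G i z\<bar>)" for z
  define s where "s z = (\<Sum>j\<in>J. \<bar>\<delta> j z\<bar>)" for z
  define h where "h z = (\<Sum>j\<in>J. \<Sum>k\<in>J. \<bar>H z j k\<bar>)" for z
  have "tight_along F g"
    unfolding g_def using tight
    by (intro tight_along_sum tight_along_abs tight_along_cmult) auto
  have "(h \<longlongrightarrow> 0) F"
    unfolding h_def by (intro tendsto_null_sum tendsto_rabs_zero H)
  then have "eventually (\<lambda>z. h z < 1 / 2) F"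
    by (rule order_tendstoD) simp
  with eq have "eventually (\<lambda>z. \<bar>s z\<bar> \<le> \<bar>2 * g z\<bar>) F"
  proof eventually_elim
    case (elim z)
    have "s z \<le> (\<Sum>j\<in>J. \<bar>\<Sum>i\<in>I. C j i * G i z\<bar> + (\<Sum>k\<in>J. \<bar>H z j k\<bar> * \<bar>\<delta> k z\<bar>))"
      unfolding s_def
    proof (rule sum_mono)
      fix j assume "j \<in> J"
      have "\<bar>\<delta> j z\<bar> \<le> \<bar>\<Sum>i\<in>I. C j i * G i z\<bar> + \<bar>\<Sum>k\<in>J. H z j k * \<delta> k z\<bar>"
        using elim(1) \<open>j \<in> J\<close> abs_triangle_ineq4[of "\<Sum>i\<in>I. C j i * G i z" "\<Sum>k\<in>J. H z j k * \<delta> k z"]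
        by simp
      also have "\<bar>\<Sum>k\<in>J. H z j k * \<delta> k z\<bar> \<le> (\<Sum>k\<in>J. \<bar>H z j k\<bar> * \<bar>\<delta> k z\<bar>)"
        using sum_abs[of "\<lambda>k. H z j k * \<delta> k z" J] by (simp add: abs_mult)
      finally show "\<bar>\<delta> j z\<bar> \<le> \<bar>\<Sum>i\<in>I. C j i * G i z\<bar> + (\<Sum>k\<in>J. \<bar>H z j k\<bar> * \<bar>\<delta> k z\<bar>)" by simp
    qed
    also have "\<dots> \<le> (\<Sum>j\<in>J. \<bar>\<Sum>i\<in>I. C j i * G i z\<bar> + (\<Sum>k\<in>J. \<bar>H z j k\<bar> * s z))"
      unfolding s_def using \<open>finite J\<close>
      by (intro sum_mono add_left_mono mult_left_mono member_le_sum) auto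
    also have "\<dots> = g z + h z * s z"
      by (simp add: g_def h_def sum.distrib sum_distrib_right)
    also have "\<dots> \<le> g z + 1 / 2 * s z"
      using elim(2) by (intro add_left_mono mult_right_mono) (auto simp: s_def sum_nonneg)
    finally have "s z \<le> 2 * g z" by simp
    moreover have "s z \<ge> 0" by (simp add: s_def sum_nonneg)
    ultimately show ?case by simp
  qed
  then have "tight_along F s"
    by (rule tight_along_mono[OF tight_along_cmult[OF \<open>tight_along F g\<close>]])
  then have \<delta>_tight: "tight_along F (\<delta> k)" if "k \<in> J" for k
  proof (rule tight_along_mono, intro always_eventually allI)
    fix z
    have "\<bar>\<delta> k z\<bar> \<le> s z"
      unfolding s_def using that \<open>finite J\<close> by (intro member_le_sum) auto
    then show "\<bar>\<delta> k z\<bar> \<le> \<bar>s z\<bar>" by simp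
  qed
  have "((\<lambda>z. - (\<Sum>k\<in>J. H z j k * \<delta> k z)) \<longlongrightarrow> - (\<Sum>k\<in>J. 0)) F"
    by (intro tendsto_minus tendsto_sum tight_alongD \<delta>_tight H)
  then have "((\<lambda>z. - (\<Sum>k\<in>J. H z j k * \<delta> k z)) \<longlongrightarrow> 0) F" by simp
  then show ?thesis
    by (rule Lim_transform_eventually) (use eq \<open>j \<in> J\<close> in \<open>auto elim!: eventually_mono\<close>)
qed

subsection \<open>Expansion of the HTC estimator\<close>

text \<open>Instruments are affine in the coefficients, so the effect of estimating them is exact,
  with no remainder term.\<close>

lemma instrument_perturbation:
  "instrument D B b v y x = instrument D B \<beta> v y x -
     (if y \<in> htr D B v then \<Sum>q\<in>pa D y. (b $ q $ y - \<beta> $ q $ y) * x $ q else 0)"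
  by (simp add: instrument_def residual_def left_diff_distrib sum_subtractf)

lemma quad_bounded_instrument_mult:
  "bounded_linear g \<Longrightarrow> quad_bounded (\<lambda>x. instrument D B b v y x * g x)"
  by (rule quad_bounded_mult_linear[OF bounded_linear_instrument])

lemma quad_bounded_nth_mult:
  "bounded_linear g \<Longrightarrow> quad_bounded (\<lambda>x. x $ q * g x)"
  by (rule quad_bounded_mult_linear[OF bounded_linear_vec_nth])

text \<open>The error vector enters the asymptotic analysis only through the fourth moment of
  \<open>P0\<close> and the moment conditions \<open>exogenous\<close>.\<close>

locale htc_estimation = iid_sample M P0 X + P: fourth_moment P0
  for M :: "'a measure" and P0 :: "(real^'v::finite) measure" and X :: "nat \<Rightarrow> 'a \<Rightarrow> real^'v" +
  fixes D :: "('v \<times> 'v) set" and B :: "'v set set" and W :: "'v set" and Y :: "'v \<Rightarrow> 'v set"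
    and prec :: "('v \<times> 'v) set" and \<beta> :: "real^'v^'v" and beta_hat :: "nat \<Rightarrow> 'a \<Rightarrow> real^'v^'v"
  assumes identified: "htc_identified D B W Y prec"
    and A_invertible: "\<And>u. u \<in> W \<Longrightarrow> invertible_on (Y u) (pa D u) (A_matrix D B \<beta> P0 u)"
    and exogenous: "\<And>u y. u \<in> W \<Longrightarrow> y \<in> Y u \<Longrightarrow>
      (\<integral>x. instrument D B \<beta> u y x * residual D \<beta> u x \<partial>P0) = 0"
    and estimator_measurable: "\<And>n. beta_hat n \<in> borel_measurable M"
    and estimator:
      "\<And>n \<omega>. \<omega> \<in> space M \<Longrightarrow> is_htc_estimate D B W Y n (\<lambda>i. X i \<omega>) (beta_hat n \<omega>)"
begin

abbreviation "resid \<equiv> residual D \<beta>"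
abbreviation "R \<equiv> R_contribution D B Y prec \<beta> P0"
abbreviation "\<phi> \<equiv> phi D B Y prec \<beta> P0"
abbreviation "A \<equiv> A_matrix D B \<beta> P0"
abbreviation "C u \<equiv> inv_on (Y u) (pa D u) (A u)"
abbreviation "F \<equiv> prob_filter M"
abbreviation "A' z \<equiv> A_hat D B (fst z) (\<lambda>i. X i (snd z)) (beta_hat (fst z) (snd z))"

definition nsum :: "(real^'v \<Rightarrow> real) \<Rightarrow> nat \<times> 'a \<Rightarrow> real" where
  "nsum f z = (\<Sum>i<fst z. f (X i (snd z))) / sqrt (fst z)"

definition smean :: "(real^'v \<Rightarrow> real) \<Rightarrow> nat \<times> 'a \<Rightarrow> real" where
  "smean f z = (\<Sum>i<fst z. f (X i (snd z))) / fst z"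

definition delta :: "'v \<Rightarrow> 'v \<Rightarrow> nat \<times> 'a \<Rightarrow> real" where
  "delta p u z = sqrt (fst z) * (beta_hat (fst z) (snd z) $ p $ u - \<beta> $ p $ u)"

text \<open>The scaled estimating function at the true coefficients of \<open>u\<close>, but with
  estimated instruments: the right-hand side of the linear system solved by
  \<open>delta\<close>.\<close>

definition G :: "'v \<Rightarrow> 'v \<Rightarrow> nat \<times> 'a \<Rightarrow> real" where
  "G u y z = sqrt (fst z) *
     smean (\<lambda>x. instrument D B (beta_hat (fst z) (snd z)) u y x * resid u x) z"

lemma prec_order: "prec \<subseteq> W \<times> W" "trans prec" "wf prec"
proof -
  show "prec \<subseteq> W \<times> W" "trans prec"
    using identified by (auto simp: htc_identified_def strict_linear_order_on_def)
  have "acyclic prec"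
    using identified by (simp add: htc_identified_def strict_linear_order_on_def acyclic_irrefl)
  then show "wf prec" by (simp add: finite_acyclic_wf)
qed

lemma prec_step: "u \<in> W \<Longrightarrow> y \<in> Y u \<Longrightarrow> y \<in> htr D B u \<Longrightarrow> (y, u) \<in> prec"
  using identified by (auto simp: htc_identified_def)

text \<open>The estimate is specified only where \<open>A_hat\<close> is invertible at all needed
  vertices; these are confined here to \<open>u\<close> and its predecessors, within reach of an
  induction along \<open>prec\<close>.\<close>

lemma needed_prec:
  assumes "u \<in> W" "w \<in> needed D B Y u"
  shows "w = u \<or> (w, u) \<in> prec"
proof -
  from assms(2) have "(w, u) \<in> {(w, u). w \<in> Y u \<inter> htr D B u}\<^sup>*" by (simp add: needed_def)
  then show ?thesis
  proof (induction rule: converse_rtrancl_induct)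
    case (step w x)
    then have "x \<in> W" using \<open>u \<in> W\<close> prec_order(1) by auto
    then have "(w, x) \<in> prec" using step(1) prec_step by blast
    then show ?case using step.IH transD[OF prec_order(2)] by blast
  qed simp
qed

lemma nsum_sum: "nsum (\<lambda>x. \<Sum>i\<in>I. c i * f i x) z = (\<Sum>i\<in>I. c i * nsum (f i) z)"
  unfolding nsum_def by (subst sum.swap) (simp add: sum_divide_distrib sum_distrib_left)

lemma nsum_diff: "nsum (\<lambda>x. f x - g x) z = nsum f z - nsum g z"
  by (simp add: nsum_def sum_subtractf diff_divide_distrib)

lemma smean_tendsto: "quad_bounded f \<Longrightarrow> (smean f \<longlongrightarrow> (\<integral>x. f x \<partial>P0)) F"
  using weak_law_of_large_numbers[of f] P.integrable_mult_quad[of f f]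
  by (simp add: smean_def[abs_def] quad_bounded_measurable power2_eq_square case_prod_unfold)

lemma nsum_tight: "quad_bounded f \<Longrightarrow> (\<integral>x. f x \<partial>P0) = 0 \<Longrightarrow> tight_along F (nsum f)"
  using tight_normalized_sum[of f] P.integrable_mult_quad[of f f]
  by (simp add: nsum_def[abs_def] quad_bounded_measurable power2_eq_square case_prod_unfold)

text \<open>One induction serves both, since the correction in \<open>R\<close> is a combination of
  \<open>\<phi>\<close> at predecessors. The mean of \<open>R\<close> vanishes by the moment
  condition and the induction hypothesis.\<close>

lemma R_phi_moments:
  assumes "u \<in> W"
  shows "(\<forall>y\<in>Y u. quad_bounded (R u y) \<and> (\<integral>x. R u y x \<partial>P0) = 0) \<and>
     (\<forall>q. quad_bounded (\<phi> u q) \<and> (\<integral>x. \<phi> u q x \<partial>P0) = 0)"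
  using assms
proof (induction u rule: wf_induct_rule[OF prec_order(3)])
  case (1 u)
  have R: "quad_bounded (R u y) \<and> (\<integral>x. R u y x \<partial>P0) = 0" if y: "y \<in> Y u" for y
  proof -
    have int: "integrable P0 (\<lambda>x. instrument D B \<beta> u y x * resid u x)"
      by (intro P.integrable_quad quad_bounded_instrument_mult bounded_linear_residual)
    show ?thesis
    proof (cases "y \<in> htr D B u")
      case True
      then have "(y, u) \<in> prec" "y \<in> W" using prec_step[OF 1(2) y] prec_order(1) by auto
      then have IH: "quad_bounded (\<phi> y q)" "(\<integral>x. \<phi> y q x \<partial>P0) = 0" for q
        using 1(1) by blast+
      have eq: "R u y = (\<lambda>x. instrument D B \<beta> u y x * resid u x
          - (\<Sum>q\<in>pa D y. (\<integral>z. z $ q * resid u z \<partial>P0) * \<phi> y q x))"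
        using True by (simp add: R_eq fun_eq_iff instrument_def)
      show ?thesis
        unfolding eq using int exogenous[OF 1(2) y]
        by (auto intro!: quad_bounded_diff quad_bounded_sum quad_bounded_cmult
            quad_bounded_instrument_mult bounded_linear_residual IH
            simp: Bochner_Integration.integral_diff Bochner_Integration.integral_sum
              P.integrable_quad IH)
    next
      case False
      then have eq: "R u y = (\<lambda>x. instrument D B \<beta> u y x * resid u x)"
        by (simp add: R_eq fun_eq_iff instrument_def)
      show ?thesis
        unfolding eq using exogenous[OF 1(2) y]
        by (simp add: quad_bounded_instrument_mult bounded_linear_residual)
    qed
  qed
  moreover have "\<phi> u q = (\<lambda>x. \<Sum>y\<in>Y u. C u q y * R u y x)" for q
    by (rule ext, rule phi_eq[OF identified 1(2)])
  ultimately show ?case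
    by (auto intro!: quad_bounded_sum quad_bounded_cmult
        simp: Bochner_Integration.integral_sum P.integrable_quad)
qed

lemma A'_eq:
  "A' z u y p = smean (\<lambda>x. instrument D B \<beta> u y x * x $ p) z
     - (if y \<in> htr D B u then \<Sum>q\<in>pa D y. (beta_hat (fst z) (snd z) $ q $ y - \<beta> $ q $ y)
          * smean (\<lambda>x. x $ q * x $ p) z else 0)"
  unfolding A_hat_def smean_def
  by (subst instrument_perturbation[where \<beta> = \<beta>])
     (simp add: left_diff_distrib sum_subtractf sum_distrib_right sum_distrib_left diff_divide_distrib
       sum_divide_distrib mult.assoc sum.swap[of _ "pa D y"])

text \<open>The error of an earlier estimate enters with the factor \<open>sqrt n\<close>, that is,
  as \<open>delta\<close>, and need not vanish in the limit. In \<open>A'_eq\<close> the same error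
  occurs unscaled.\<close>

lemma G_eq:
  "G u y z = nsum (\<lambda>x. instrument D B \<beta> u y x * resid u x) z
     - (if y \<in> htr D B u then \<Sum>q\<in>pa D y. delta q y z * smean (\<lambda>x. x $ q * resid u x) z else 0)"
proof -
  have sqrt: "sqrt (fst z) * (a / fst z) = a / sqrt (fst z)" for a
    by (cases "fst z = 0") (simp_all add: field_simps)
  have "G u y z = sqrt (fst z) * (smean (\<lambda>x. instrument D B \<beta> u y x * resid u x) z
     - (if y \<in> htr D B u then \<Sum>q\<in>pa D y. (beta_hat (fst z) (snd z) $ q $ y - \<beta> $ q $ y)
          * smean (\<lambda>x. x $ q * resid u x) z else 0))"
    unfolding G_def smean_def
    by (subst instrument_perturbation[where \<beta> = \<beta>])
       (simp add: left_diff_distrib sum_subtractf sum_distrib_right sum_distrib_left diff_divide_distrib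
         sum_divide_distrib mult.assoc sum.swap[of _ "pa D y"])
  moreover have "sqrt (fst z) * smean f z = nsum f z" for f
    by (simp only: smean_def nsum_def sqrt)
  ultimately show ?thesis
    by (cases "y \<in> htr D B u")
       (simp_all add: right_diff_distrib[of _ "smean f z" for f] sum_distrib_left delta_def mult.assoc)
qed

text \<open>Multiplying the estimate by \<open>A'\<close> gives \<open>b_hat\<close>; subtracting
  \<open>A'\<close> times the true coefficients leaves the sample mean of instrument times
  residual.\<close>

lemma estimating_equation:
  assumes u: "u \<in> W" and "snd z \<in> space M"
    and inv: "\<And>w. w = u \<or> (w, u) \<in> prec \<Longrightarrow> invertible_on (Y w) (pa D w) (A' z w)"
    and y: "y \<in> Y u"
  shows "(\<Sum>p\<in>pa D u. A' z u y p * delta p u z) = G u y z"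
proof -
  let ?b = "beta_hat (fst z) (snd z)"
  let ?bh = "b_hat D B (fst z) (\<lambda>i. X i (snd z)) ?b u"
  let ?Ci = "inv_on (Y u) (pa D u) (A' z u)"
  have "\<forall>p\<in>pa D u. ?b $ p $ u = (\<Sum>y\<in>Y u. ?Ci p y * ?bh y)"
    using estimator[OF assms(2)] u needed_prec[OF u] inv unfolding is_htc_estimate_def by blast
  then have "(\<Sum>p\<in>pa D u. A' z u y p * ?b $ p $ u) = (\<Sum>p\<in>pa D u. \<Sum>y'\<in>Y u. A' z u y p * ?Ci p y' * ?bh y')"
    by (simp add: sum_distrib_left mult.assoc)
  also have "\<dots> = (\<Sum>y'\<in>Y u. (\<Sum>p\<in>pa D u. A' z u y p * ?Ci p y') * ?bh y')"
    by (subst sum.swap) (simp add: sum_distrib_right)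
  also have "\<dots> = ?bh y"
    using y inverse_onD(1)[OF inverse_on_inv_on[OF inv[of u]] y] by (simp cong: sum.cong)
  finally have "(\<Sum>p\<in>pa D u. A' z u y p * (?b $ p $ u - \<beta> $ p $ u))
      = ?bh y - (\<Sum>p\<in>pa D u. A' z u y p * \<beta> $ p $ u)"
    by (simp add: right_diff_distrib sum_subtractf)
  also have "\<dots> = smean (\<lambda>x. instrument D B ?b u y x * resid u x) z"
    by (simp add: A_hat_def b_hat_def smean_def residual_def right_diff_distrib sum_subtractf
        diff_divide_distrib sum_distrib_left sum_distrib_right sum_divide_distrib mult_ac
        sum.swap[of _ "pa D u"])
  finally show ?thesis
    by (simp add: delta_def G_def sum_distrib_left[symmetric] mult.left_commute[of _ "sqrt (fst z)"])
qed

text \<open>In one step along the HTC ordering, the estimation error of the predecessors changes \<open>A'\<close> only by \<open>o(1)\<close>,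
  but it changes the estimating equation \<open>G\<close> by exactly the correction term in \<open>R\<close>.\<close>

lemma delta_expansion:
  assumes "u \<in> W"
  shows "eventually (\<lambda>z. invertible_on (Y u) (pa D u) (A' z u)) F \<and>
    (\<forall>p\<in>pa D u. ((\<lambda>z. delta p u z - nsum (\<phi> u p) z) \<longlongrightarrow> 0) F)"
  using assms
proof (induction u rule: wf_induct_rule[OF prec_order(3)])
  case (1 u)
  have pred: "y \<in> W" "((\<lambda>z. delta q y z - nsum (\<phi> y q) z) \<longlongrightarrow> 0) F" "tight_along F (nsum (\<phi> y q))"
    if "y \<in> Y u" "y \<in> htr D B u" "q \<in> pa D y" for y q
  proof -
    have y: "(y, u) \<in> prec" "y \<in> W" using prec_step[OF 1(2) that(1,2)] prec_order(1) by auto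
    then show "y \<in> W" "((\<lambda>z. delta q y z - nsum (\<phi> y q) z) \<longlongrightarrow> 0) F"
      using 1(1) that(3) by blast+
    show "tight_along F (nsum (\<phi> y q))"
      using R_phi_moments[OF y(2)] by (intro nsum_tight) auto
  qed
  \<comment> \<open>Consistency of the earlier estimates: \<open>delta\<close> is tight, and the
    estimation error is \<open>delta\<close> divided by \<open>sqrt n\<close>.\<close>
  have b_lim: "((\<lambda>z. beta_hat (fst z) (snd z) $ q $ y - \<beta> $ q $ y) \<longlongrightarrow> 0) F"
    if "y \<in> Y u" "y \<in> htr D B u" "q \<in> pa D y" for y q
  proof -
    have "tight_along F (\<lambda>z. (delta q y z - nsum (\<phi> y q) z) + nsum (\<phi> y q) z)"
      by (intro tight_along_add tight_along_tendsto[OF pred(2)] pred(3) that)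
    then have "tight_along F (delta q y)" by simp
    moreover have "((\<lambda>z. 1 / sqrt (fst z)) \<longlongrightarrow> 0) F"
      by (rule tendsto_prob_filter_sequentially, real_asymp)
    ultimately have "((\<lambda>z. 1 / sqrt (fst z) * delta q y z) \<longlongrightarrow> 0) F"
      by (rule tight_alongD)
    then show ?thesis
    proof (rule Lim_transform_eventually)
      have "\<forall>\<^sub>F (n, \<omega>) in F. n > (0::nat)"
        by (rule eventually_prob_filter_sequentially) (rule eventually_gt_at_top)
      then show "\<forall>\<^sub>F z in F. 1 / sqrt (fst z) * delta q y z = beta_hat (fst z) (snd z) $ q $ y - \<beta> $ q $ y"
        by eventually_elim (auto simp: delta_def)
    qed
  qed
  have A_lim: "((\<lambda>z. A' z u y p) \<longlongrightarrow> A u y p) F" if y: "y \<in> Y u" for y p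
  proof -
    have 1: "(smean (\<lambda>x. instrument D B \<beta> u y x * x $ p) \<longlongrightarrow> A u y p) F"
      unfolding A_matrix_def
      by (intro smean_tendsto quad_bounded_instrument_mult bounded_linear_vec_nth)
    have 2: "((\<lambda>z. (beta_hat (fst z) (snd z) $ q $ y - \<beta> $ q $ y) * smean (\<lambda>x. x $ q * x $ p) z) \<longlongrightarrow> 0) F"
      if "y \<in> htr D B u" "q \<in> pa D y" for q
      by (rule tight_alongD[OF tight_along_tendsto[OF smean_tendsto] b_lim[OF y that]])
         (intro quad_bounded_nth_mult bounded_linear_vec_nth)
    show ?thesis
    proof (cases "y \<in> htr D B u")
      case True
      have "((\<lambda>z. A' z u y p) \<longlongrightarrow> A u y p - (\<Sum>q\<in>pa D y. 0)) F"
        unfolding A'_eq using True by (simp only: if_True) (intro tendsto_diff 1 tendsto_sum 2)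
      then show ?thesis by simp
    next
      case False
      then show ?thesis using 1 by (simp add: A'_eq)
    qed
  qed
  have G_lim: "((\<lambda>z. G u y z - nsum (R u y) z) \<longlongrightarrow> 0) F" if y: "y \<in> Y u" for y
  proof (cases "y \<in> htr D B u")
    case True
    let ?m = "\<lambda>q. \<integral>x. x $ q * resid u x \<partial>P0"
    \<comment> \<open>The difference \<open>delta * smean - m * nsum \<phi>\<close> is split as
      \<open>(delta - nsum \<phi>) * smean + (smean - m) * nsum \<phi>\<close>: in each summand one
      factor vanishes and the other is tight.\<close>
    have "((\<lambda>z. \<Sum>q\<in>pa D y. - ((delta q y z - nsum (\<phi> y q) z) * smean (\<lambda>x. x $ q * resid u x) z)
        - (smean (\<lambda>x. x $ q * resid u x) z - ?m q) * nsum (\<phi> y q) z) \<longlongrightarrow> (\<Sum>q\<in>pa D y. - 0 - 0)) F"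
    proof (intro tendsto_sum tendsto_diff tendsto_minus)
      fix q assume q: "q \<in> pa D y"
      have lim: "(smean (\<lambda>x. x $ q * resid u x) \<longlongrightarrow> ?m q) F"
        by (intro smean_tendsto quad_bounded_nth_mult bounded_linear_residual)
      show "((\<lambda>z. (delta q y z - nsum (\<phi> y q) z) * smean (\<lambda>x. x $ q * resid u x) z) \<longlongrightarrow> 0) F"
        by (rule tight_alongD[OF tight_along_tendsto[OF lim] pred(2)[OF y True q]])
      show "((\<lambda>z. (smean (\<lambda>x. x $ q * resid u x) z - ?m q) * nsum (\<phi> y q) z) \<longlongrightarrow> 0) F"
        by (rule tight_alongD[OF pred(3)[OF y True q]]) (use lim in \<open>rule LIM_zero\<close>)
    qed
    moreover have "R u y = (\<lambda>x. instrument D B \<beta> u y x * resid u x - (\<Sum>q\<in>pa D y. ?m q * \<phi> y q x))"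
      using True by (simp add: R_eq fun_eq_iff instrument_def)
    then have "G u y z - nsum (R u y) z
        = (\<Sum>q\<in>pa D y. - ((delta q y z - nsum (\<phi> y q) z) * smean (\<lambda>x. x $ q * resid u x) z)
        - (smean (\<lambda>x. x $ q * resid u x) z - ?m q) * nsum (\<phi> y q) z)" for z
      using True by (simp add: G_eq nsum_diff nsum_sum)
        (simp add: algebra_simps sum_subtractf sum.distrib sum_negf)
    ultimately show ?thesis by simp
  next
    case False
    then have "R u y = (\<lambda>x. instrument D B \<beta> u y x * resid u x)"
      by (simp add: R_eq fun_eq_iff instrument_def)
    then show ?thesis using False by (simp add: G_eq)
  qed
  have G_tight: "tight_along F (G u y)" if "y \<in> Y u" for y
  proof -
    have "tight_along F (\<lambda>z. (G u y z - nsum (R u y) z) + nsum (R u y) z)"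
      using R_phi_moments[OF 1(2)] that
      by (intro tight_along_add tight_along_tendsto[OF G_lim] nsum_tight) auto
    then show ?thesis by simp
  qed
  have inv: "inverse_on (Y u) (pa D u) (A u) (C u)"
    by (rule inverse_on_inv_on[OF A_invertible[OF 1(2)]])
  have inv_u: "eventually (\<lambda>z. invertible_on (Y u) (pa D u) (A' z u)) F"
    by (rule eventually_invertible_on[OF _ inv]) (simp_all add: A_lim)
  \<comment> \<open>The system is derived where all needed matrices are invertible, which is why
    invertibility belongs to the induction statement; there are only finitely many
    predecessors.\<close>
  have "eventually (\<lambda>z. \<forall>w\<in>{w. w = u \<or> (w, u) \<in> prec}. invertible_on (Y w) (pa D w) (A' z w)) F"
    by (rule eventually_ball_finite) (use 1(1) prec_order(1) inv_u in auto)
  with eventually_in_space_prob_filter[of M]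
  have system: "eventually (\<lambda>z. \<forall>y\<in>Y u. (\<Sum>p\<in>pa D u. A' z u y p * delta p u z) = G u y z) F"
    by eventually_elim (use estimating_equation[OF 1(2)] in blast)
  have "((\<lambda>z. delta p u z - nsum (\<phi> u p) z) \<longlongrightarrow> 0) F" if p: "p \<in> pa D u" for p
  proof -
    have "((\<lambda>z. delta p u z - (\<Sum>y\<in>Y u. C u p y * G u y z)) \<longlongrightarrow> 0) F"
      by (rule linear_system_expansion[OF _ _ inv _ _ system p]) (simp_all add: A_lim G_tight)
    moreover have "((\<lambda>z. \<Sum>y\<in>Y u. C u p y * (G u y z - nsum (R u y) z)) \<longlongrightarrow> (\<Sum>y\<in>Y u. C u p y * 0)) F"
      by (intro tendsto_sum tendsto_mult tendsto_const G_lim)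
    ultimately have "((\<lambda>z. (delta p u z - (\<Sum>y\<in>Y u. C u p y * G u y z))
        + (\<Sum>y\<in>Y u. C u p y * (G u y z - nsum (R u y) z))) \<longlongrightarrow> 0 + (\<Sum>y\<in>Y u. C u p y * 0)) F"
      by (rule tendsto_add)
    moreover have "\<phi> u p = (\<lambda>x. \<Sum>y\<in>Y u. C u p y * R u y x)"
      by (rule ext, rule phi_eq[OF identified 1(2)])
    ultimately show ?thesis
      by (simp add: nsum_sum right_diff_distrib sum_subtractf)
  qed
  with inv_u show ?case by blast
qed

text \<open>\<open>\<phi>\<close> is \<open>C\<close> applied to \<open>R\<close>, so the sandwich
  formula is the second-moment matrix of \<open>\<phi>\<close>.\<close>

lemma asymptotic_covariance_eq:
  assumes "v \<in> W"
  shows "asymptotic_covariance D B Y prec \<beta> P0 v p q = (\<integral>x. \<phi> v p x * \<phi> v q x \<partial>P0)"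
proof -
  have R: "quad_bounded (R v y)" if "y \<in> Y v" for y using R_phi_moments[OF assms] that by blast
  have "(\<integral>x. \<phi> v p x * \<phi> v q x \<partial>P0)
      = (\<integral>x. (\<Sum>a\<in>Y v. \<Sum>b\<in>Y v. C v p a * C v q b * (R v a x * R v b x)) \<partial>P0)"
    by (simp add: phi_eq[OF identified assms] sum_product mult_ac)
  also have "\<dots> = (\<Sum>a\<in>Y v. \<Sum>b\<in>Y v. C v p a * C v q b * (\<integral>x. R v a x * R v b x \<partial>P0))"
    by (simp add: Bochner_Integration.integral_sum P.integrable_mult_quad R)
  finally show ?thesis
    by (simp only: asymptotic_covariance_def Let_def mult.assoc mult.commute[of "integral\<^sup>L P0 _"])
qed

abbreviation "V v \<equiv> asymptotic_covariance D B Y prec \<beta> P0 v"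

text \<open>This serves twice: it shows positive semidefiniteness, and it identifies the variance in
  the central limit theorem for a linear combination.\<close>

lemma quadratic_form_V:
  assumes "v \<in> W"
  shows "(\<Sum>p\<in>I. \<Sum>q\<in>I. t p * V v p q * t q) = (\<integral>x. (\<Sum>p\<in>I. t p * \<phi> v p x)\<^sup>2 \<partial>P0)"
proof -
  have \<phi>: "quad_bounded (\<phi> v q)" for q using R_phi_moments[OF assms] by blast
  have "(\<integral>x. (\<Sum>p\<in>I. t p * \<phi> v p x)\<^sup>2 \<partial>P0)
      = (\<integral>x. (\<Sum>p\<in>I. \<Sum>q\<in>I. t p * t q * (\<phi> v p x * \<phi> v q x)) \<partial>P0)"
    by (simp add: power2_eq_square sum_product mult_ac)
  also have "\<dots> = (\<Sum>p\<in>I. \<Sum>q\<in>I. t p * t q * V v p q)"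
    by (simp add: Bochner_Integration.integral_sum P.integrable_mult_quad \<phi> asymptotic_covariance_eq[OF assms])
  finally show ?thesis by (simp add: mult_ac)
qed

lemma psd_V: "v \<in> W \<Longrightarrow> psd_on I (V v)"
  by (simp add: psd_on_def quadratic_form_V) (simp add: asymptotic_covariance_eq mult.commute)

lemma delta_measurable [measurable]: "(\<lambda>\<omega>. delta p u (n, \<omega>)) \<in> borel_measurable M"
proof -
  have "(\<lambda>b::real^'v^'v. b $ p $ u) \<in> borel_measurable borel"
    by (intro borel_measurable_continuous_onI continuous_intros)
  from measurable_compose[OF estimator_measurable this] show ?thesis
    by (simp add: delta_def)
qed

text \<open>For fixed \<open>t\<close> the expansion replaces \<open>delta\<close> by a normalized
  i.i.d. sum. Arbitrary \<open>t\<close> gives the joint limit, unit vectors the single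
  edges.\<close>

lemma char_delta:
  assumes "v \<in> W"
  shows "(\<lambda>n. char (distr M borel (\<lambda>\<omega>. \<Sum>p\<in>pa D v. t p * delta p v (n, \<omega>))) s)
    \<longlonglongrightarrow> exp (- (s\<^sup>2 * (\<Sum>p\<in>pa D v. \<Sum>q\<in>pa D v. t p * V v p q * t q)) / 2)"
proof -
  define f where "f x = (\<Sum>p\<in>pa D v. t p * \<phi> v p x)" for x
  have \<phi>: "quad_bounded (\<phi> v q)" "(\<integral>x. \<phi> v q x \<partial>P0) = 0" for q
    using R_phi_moments[OF assms] by blast+
  have f: "quad_bounded f" "(\<integral>x. f x \<partial>P0) = 0"
    unfolding f_def
    by (auto intro!: quad_bounded_sum quad_bounded_cmult \<phi>
        simp: Bochner_Integration.integral_sum P.integrable_quad \<phi>)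
  have [measurable]: "f \<in> borel_measurable borel" using f by (simp add: quad_bounded_measurable)
  let ?N = "distr std_normal_distribution borel ((*) (sqrt (\<integral>x. (f x)\<^sup>2 \<partial>P0)))"
  have "(\<lambda>n. char (distr M borel (\<lambda>\<omega>. \<Sum>p\<in>pa D v. t p * delta p v (n, \<omega>))) s) \<longlonglongrightarrow> char ?N s"
  proof (rule slutsky_char)
    have "((\<lambda>z. \<Sum>p\<in>pa D v. t p * (delta p v z - nsum (\<phi> v p) z)) \<longlongrightarrow> (\<Sum>p\<in>pa D v. t p * 0)) F"
      using delta_expansion[OF assms] by (intro tendsto_sum tendsto_mult tendsto_const) blast
    then show "((\<lambda>(n, \<omega>). (\<Sum>p\<in>pa D v. t p * delta p v (n, \<omega>)) - nsum f (n, \<omega>)) \<longlongrightarrow> 0) F"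
      by (simp add: f_def[abs_def] nsum_sum right_diff_distrib sum_subtractf case_prod_unfold)
    show "(\<lambda>n. char (distr M borel (\<lambda>\<omega>. nsum f (n, \<omega>))) t) \<longlonglongrightarrow> char ?N t" for t
      using char_normalized_sum[of f t] f P.integrable_mult_quad[OF f(1) f(1)]
      by (simp add: nsum_def power2_eq_square)
    show "(\<lambda>\<omega>. nsum f (n, \<omega>)) \<in> borel_measurable M" for n by (simp add: nsum_def)
  qed simp
  then show ?thesis
    unfolding quadratic_form_V[OF assms] f_def[symmetric]
    by (simp add: char_scaled_std_normal power_mult_distrib mult.commute)
qed

end

subsection \<open>Asymptotic normality\<close>

lemma unit_quadratic_form:
  assumes "finite I" "p \<in> I"
  shows "(\<Sum>a\<in>I. \<Sum>b\<in>I. of_bool (a = p) * S a b * of_bool (b = p)) = (S p p :: real)"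
proof -
  have "(\<Sum>a\<in>I. \<Sum>b\<in>I. of_bool (a = p) * S a b * of_bool (b = p))
      = (\<Sum>a\<in>I. of_bool (a = p) * (\<Sum>b\<in>I. S a b * of_bool (b = p)))"
    by (simp only: sum_distrib_left mult.assoc)
  then show ?thesis using assms by simp
qed

context htc_estimation
begin

lemma asymptotic_normality:
  assumes "v \<in> W"
  shows "\<exists>N. multivariate_normal (pa D v) (V v) N \<and>
    weak_conv_on (pa D v) (\<lambda>n. distr M (\<Pi>\<^sub>M p\<in>pa D v. borel) (\<lambda>\<omega>. \<lambda>p\<in>pa D v. delta p v (n, \<omega>))) N"
proof -
  obtain N where N: "multivariate_normal (pa D v) (V v) N"
    using multivariate_normal_exists[OF _ psd_V[OF assms]] by fastforce
  have [measurable]: "(\<lambda>\<omega>. \<lambda>p\<in>pa D v. delta p v (n, \<omega>)) \<in> M \<rightarrow>\<^sub>M (\<Pi>\<^sub>M p\<in>pa D v. borel)" for n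
    by (intro measurable_restrict) simp
  have "weak_conv_on (pa D v)
      (\<lambda>n. distr M (\<Pi>\<^sub>M p\<in>pa D v. borel) (\<lambda>\<omega>. \<lambda>p\<in>pa D v. delta p v (n, \<omega>))) N"
  proof (rule weak_conv_on_multivariate_normalI[OF _ _ N])
    show "(\<lambda>n. char (distr (distr M (\<Pi>\<^sub>M p\<in>pa D v. borel) (\<lambda>\<omega>. \<lambda>p\<in>pa D v. delta p v (n, \<omega>)))
          borel (\<lambda>z. \<Sum>p\<in>pa D v. t p * z p)) s)
        \<longlonglongrightarrow> exp (- (s\<^sup>2 * (\<Sum>i\<in>pa D v. \<Sum>j\<in>pa D v. t i * V v i j * t j)) / 2)" for t s
      using char_delta[OF assms, of t s] by (simp add: distr_distr comp_def cong: sum.cong)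
  qed (simp_all add: prob_space_distr)
  with N show ?thesis by blast
qed

lemma asymptotic_normality_coordinate:
  assumes "v \<in> W" and p: "p \<in> pa D v"
  shows "weak_conv_m (\<lambda>n. distr M borel (\<lambda>\<omega>. delta p v (n, \<omega>)))
    (distr std_normal_distribution borel (\<lambda>z. sqrt (V v p p) * z))"
proof (rule levy_continuity)
  show "real_distribution (distr M borel (\<lambda>\<omega>. delta p v (n, \<omega>)))" for n
    by (intro real_distribution_distr) simp
  interpret N: real_distribution std_normal_distribution by (rule real_dist_normal_dist)
  show "real_distribution (distr std_normal_distribution borel (\<lambda>z. sqrt (V v p p) * z))"
    by (intro N.real_distribution_distr) simp
  have "V v p p \<ge> 0"
    using assms(1) by (simp add: asymptotic_covariance_eq)
  then show "(\<lambda>n. char (distr M borel (\<lambda>\<omega>. delta p v (n, \<omega>))) t)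
      \<longlonglongrightarrow> char (distr std_normal_distribution borel (\<lambda>z. sqrt (V v p p) * z)) t" for t
    using char_delta[OF assms(1), of "\<lambda>q. of_bool (q = p)" t] p
    unfolding unit_quadratic_form[OF finite p]
    by (simp add: char_scaled_std_normal power_mult_distrib mult.commute[of "t\<^sup>2"])
qed

lemma R_cross_moments:
  assumes v: "v \<in> W" and a: "a \<in> Y v" and b: "b \<in> Y v"
  defines "E \<equiv> \<lambda>f :: real^'v \<Rightarrow> real. integral\<^sup>L P0 f"
  shows "integrable P0 (\<lambda>x. R v a x * R v b x)"
    and "a \<notin> htr D B v \<Longrightarrow> b \<notin> htr D B v \<Longrightarrow>
      E (\<lambda>x. R v a x * R v b x) = E (\<lambda>x. x $ a * x $ b * (resid v x)\<^sup>2)"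
    and "a \<in> htr D B v \<Longrightarrow> b \<notin> htr D B v \<Longrightarrow>
      E (\<lambda>x. R v a x * R v b x) = E (\<lambda>x. resid a x * x $ b * (resid v x)\<^sup>2)
        - (\<Sum>q\<in>pa D a. E (\<lambda>x. x $ q * resid v x) * E (\<lambda>x. \<phi> a q x * x $ b * resid v x))"
    and "a \<in> htr D B v \<Longrightarrow> b \<in> htr D B v \<Longrightarrow>
      E (\<lambda>x. R v a x * R v b x) = E (\<lambda>x. resid a x * resid b x * (resid v x)\<^sup>2)
        - (\<Sum>r\<in>pa D b. E (\<lambda>x. x $ r * resid v x) * E (\<lambda>x. resid a x * resid v x * \<phi> b r x))
        - (\<Sum>q\<in>pa D a. E (\<lambda>x. x $ q * resid v x) * E (\<lambda>x. \<phi> a q x * resid b x * resid v x))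
        + (\<Sum>q\<in>pa D a. \<Sum>r\<in>pa D b. E (\<lambda>x. x $ q * resid v x) * E (\<lambda>x. x $ r * resid v x)
            * E (\<lambda>x. \<phi> a q x * \<phi> b r x))"
proof -
  show "integrable P0 (\<lambda>x. R v a x * R v b x)"
    using R_phi_moments[OF v] a b by (intro P.integrable_mult_quad) auto
  show "E (\<lambda>x. R v a x * R v b x) = E (\<lambda>x. x $ a * x $ b * (resid v x)\<^sup>2)"
    if "a \<notin> htr D B v" "b \<notin> htr D B v"
    using that by (simp add: R_eq power2_eq_square mult_ac)
  have in_W: "y \<in> W" if "y \<in> Y v" "y \<in> htr D B v" for y
    using prec_step[OF v that] prec_order(1) by auto
  have \<phi>: "quad_bounded (\<phi> y q)" if "y \<in> Y v" "y \<in> htr D B v" for y q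
    using R_phi_moments[OF in_W[OF that]] by blast
  have resid: "quad_bounded (\<lambda>x. resid y x * resid v x)" for y
    by (intro quad_bounded_mult_linear bounded_linear_residual)
  have coord: "quad_bounded (\<lambda>x. x $ y * resid v x)" for y
    by (intro quad_bounded_nth_mult bounded_linear_residual)
  let ?m = "\<lambda>q. E (\<lambda>x. x $ q * resid v x)"
  show "E (\<lambda>x. R v a x * R v b x) = E (\<lambda>x. resid a x * x $ b * (resid v x)\<^sup>2)
        - (\<Sum>q\<in>pa D a. ?m q * E (\<lambda>x. \<phi> a q x * x $ b * resid v x))"
    if a_htr: "a \<in> htr D B v" and "b \<notin> htr D B v"
  proof -
    \<comment> \<open>Each term is grouped as a product of two quadratically bounded functions, so
      that it is integrable and the integral may be split.\<close>
    have "E (\<lambda>x. R v a x * R v b x)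
        = E (\<lambda>x. (resid a x * resid v x) * (x $ b * resid v x)
            - (\<Sum>q\<in>pa D a. ?m q * (\<phi> a q x * (x $ b * resid v x))))"
      using that unfolding R_eq E_def
      by (simp add: left_diff_distrib sum_distrib_right mult.assoc)
    also have "\<dots> = E (\<lambda>x. (resid a x * resid v x) * (x $ b * resid v x))
        - (\<Sum>q\<in>pa D a. ?m q * E (\<lambda>x. \<phi> a q x * (x $ b * resid v x)))"
      unfolding E_def
      by (simp add: Bochner_Integration.integral_diff Bochner_Integration.integral_sum
          P.integrable_mult_quad resid coord \<phi>[OF a a_htr])
    finally show ?thesis by (simp add: power2_eq_square mult_ac)
  qed
  show "E (\<lambda>x. R v a x * R v b x) = E (\<lambda>x. resid a x * resid b x * (resid v x)\<^sup>2)
        - (\<Sum>r\<in>pa D b. ?m r * E (\<lambda>x. resid a x * resid v x * \<phi> b r x))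
        - (\<Sum>q\<in>pa D a. ?m q * E (\<lambda>x. \<phi> a q x * resid b x * resid v x))
        + (\<Sum>q\<in>pa D a. \<Sum>r\<in>pa D b. ?m q * ?m r * E (\<lambda>x. \<phi> a q x * \<phi> b r x))"
    if a_htr: "a \<in> htr D B v" and b_htr: "b \<in> htr D B v"
  proof -
    have "E (\<lambda>x. R v a x * R v b x)
        = E (\<lambda>x. (resid a x * resid v x) * (resid b x * resid v x)
            - (\<Sum>r\<in>pa D b. ?m r * (resid a x * resid v x * \<phi> b r x))
            - (\<Sum>q\<in>pa D a. ?m q * (\<phi> a q x * (resid b x * resid v x)))
            + (\<Sum>q\<in>pa D a. \<Sum>r\<in>pa D b. ?m q * ?m r * (\<phi> a q x * \<phi> b r x)))"
    proof -
      have "(s - (\<Sum>q\<in>pa D a. ?m q * \<phi> a q x)) * (t - (\<Sum>r\<in>pa D b. ?m r * \<phi> b r x))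
          = s * t - (\<Sum>r\<in>pa D b. ?m r * (s * \<phi> b r x)) - (\<Sum>q\<in>pa D a. ?m q * (\<phi> a q x * t))
            + (\<Sum>q\<in>pa D a. \<Sum>r\<in>pa D b. ?m q * ?m r * (\<phi> a q x * \<phi> b r x))" for s t x
      proof -
        let ?P = "\<Sum>q\<in>pa D a. ?m q * \<phi> a q x" and ?Q = "\<Sum>r\<in>pa D b. ?m r * \<phi> b r x"
        have "(s - ?P) * (t - ?Q) = s * t - s * ?Q - ?P * t + ?P * ?Q"
          by (simp add: algebra_simps)
        moreover have "s * ?Q = (\<Sum>r\<in>pa D b. ?m r * (s * \<phi> b r x))"
          by (simp add: sum_distrib_left mult_ac)
        moreover have "?P * t = (\<Sum>q\<in>pa D a. ?m q * (\<phi> a q x * t))"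
          by (simp add: sum_distrib_left sum_distrib_right mult_ac)
        moreover have "?P * ?Q = (\<Sum>q\<in>pa D a. \<Sum>r\<in>pa D b. ?m q * ?m r * (\<phi> a q x * \<phi> b r x))"
          by (simp add: sum_product mult_ac)
        ultimately show ?thesis by simp
      qed
      then show ?thesis
        using that unfolding R_eq E_def by simp
    qed
    also have "\<dots> = E (\<lambda>x. (resid a x * resid v x) * (resid b x * resid v x))
            - (\<Sum>r\<in>pa D b. ?m r * E (\<lambda>x. resid a x * resid v x * \<phi> b r x))
            - (\<Sum>q\<in>pa D a. ?m q * E (\<lambda>x. \<phi> a q x * (resid b x * resid v x)))
            + (\<Sum>q\<in>pa D a. \<Sum>r\<in>pa D b. ?m q * ?m r * E (\<lambda>x. \<phi> a q x * \<phi> b r x))"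
      unfolding E_def
      by (simp add: Bochner_Integration.integral_diff Bochner_Integration.integral_add
          Bochner_Integration.integral_sum P.integrable_mult_quad resid \<phi>[OF a a_htr] \<phi>[OF b b_htr])
    finally show ?thesis by (simp add: power2_eq_square mult_ac)
  qed
qed

end

theorem proposition9:
  fixes D :: "('v::finite \<times> 'v) set" and B :: "'v set set"
    and W :: "'v set" and Y :: "'v \<Rightarrow> 'v set" and prec :: "('v \<times> 'v) set"
    and \<beta> :: "real^'v^'v" and \<Omega> :: "'b measure" and \<epsilon> :: "'b \<Rightarrow> real^'v"
    and P0 :: "(real^'v) measure"
    and M :: "'a measure" and X :: "nat \<Rightarrow> 'a \<Rightarrow> real^'v"
    and beta_hat :: "nat \<Rightarrow> 'a \<Rightarrow> real^'v^'v"
    and v :: 'v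
  assumes graph: "mixed_graph D B"
    and identified: "htc_identified D B W Y prec"
    and beta: "\<beta> \<in> coefficient_matrices D"
    and error: "error_vector B \<Omega> \<epsilon>"
    and P0: "P0 = model_dist \<beta> \<Omega> \<epsilon>"
    and A_invertible: "\<And>u. u \<in> W \<Longrightarrow> invertible_on (Y u) (pa D u) (A_matrix D B \<beta> P0 u)"
    and prob: "prob_space M"
    and indep: "prob_space.indep_vars M (\<lambda>_. borel) X UNIV"
    and distributed: "\<And>i. distr M borel (X i) = P0"
    and estimator_measurable: "\<And>n. beta_hat n \<in> borel_measurable M"
    and estimator:
      "\<And>n \<omega>. \<omega> \<in> space M \<Longrightarrow> is_htc_estimate D B W Y n (\<lambda>i. X i \<omega>) (beta_hat n \<omega>)"
    and v: "v \<in> W"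
  shows
    "let eps = residual D \<beta>;
         R = R_contribution D B Y prec \<beta> P0 v;
         \<phi> = (\<lambda>q u. phi D B Y prec \<beta> P0 u q);
         V = asymptotic_covariance D B Y prec \<beta> P0 v;
         E = (\<lambda>f :: real^'v \<Rightarrow> real. integral\<^sup>L P0 f)
     in
       (\<exists>N. multivariate_normal (pa D v) V N \<and>
          weak_conv_on (pa D v)
            (\<lambda>n. distr M (\<Pi>\<^sub>M p\<in>pa D v. borel)
                   (\<lambda>\<omega>. \<lambda>p\<in>pa D v. sqrt (real n) * (beta_hat n \<omega> $ p $ v - \<beta> $ p $ v))) N) \<and>
       (\<forall>p\<in>pa D v.
          weak_conv_m
            (\<lambda>n. distr M borel (\<lambda>\<omega>. sqrt (real n) * (beta_hat n \<omega> $ p $ v - \<beta> $ p $ v)))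
            (distr std_normal_distribution borel (\<lambda>z. sqrt (V p p) * z)) \<and>
          V p p = (\<Sum>a\<in>pa D v. \<Sum>b\<in>pa D v. of_bool (a = p) * V a b * of_bool (b = p))) \<and>
       (\<forall>a\<in>Y v. \<forall>b\<in>Y v.
          integrable P0 (\<lambda>x. R a x * R b x) \<and>
          (a \<notin> htr D B v \<and> b \<notin> htr D B v \<longrightarrow>
             E (\<lambda>x. R a x * R b x) = E (\<lambda>x. x $ a * x $ b * (eps v x)\<^sup>2)) \<and>
          (a \<in> htr D B v \<and> b \<notin> htr D B v \<longrightarrow>
             E (\<lambda>x. R a x * R b x) =
               E (\<lambda>x. eps a x * x $ b * (eps v x)\<^sup>2)
               - (\<Sum>q\<in>pa D a. E (\<lambda>x. x $ q * eps v x) * E (\<lambda>x. \<phi> q a x * x $ b * eps v x))) \<and>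
          (a \<in> htr D B v \<and> b \<in> htr D B v \<longrightarrow>
             E (\<lambda>x. R a x * R b x) =
               E (\<lambda>x. eps a x * eps b x * (eps v x)\<^sup>2)
               - (\<Sum>r\<in>pa D b. E (\<lambda>x. x $ r * eps v x) * E (\<lambda>x. eps a x * eps v x * \<phi> r b x))
               - (\<Sum>q\<in>pa D a. E (\<lambda>x. x $ q * eps v x) * E (\<lambda>x. \<phi> q a x * eps b x * eps v x))
               + (\<Sum>q\<in>pa D a. \<Sum>r\<in>pa D b.
                    E (\<lambda>x. x $ q * eps v x) * E (\<lambda>x. x $ r * eps v x)
                    * E (\<lambda>x. \<phi> q a x * \<phi> r b x))))"
proof -
  interpret prob_space M by fact
  interpret iid_sample M P0 X
    by unfold_locales (fact indep, fact distributed)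
  interpret P: fourth_moment P0
    unfolding P0 by (rule fourth_moment_model_dist[OF error])
  interpret htc_estimation M P0 X D B W Y prec \<beta> beta_hat
  proof unfold_locales
    \<comment> \<open>Here the half-trek criterion meets the error distribution; what follows relies
      on the resulting moment conditions.\<close>
    show "(\<integral>x. instrument D B \<beta> u y x * residual D \<beta> u x \<partial>P0) = 0" if "u \<in> W" "y \<in> Y u" for u y
      unfolding P0 using identified that
      by (intro instrument_exogenous[OF beta error]) (auto simp: htc_identified_def)
  qed (fact identified estimator_measurable | erule A_invertible | erule estimator)+
  show ?thesis
    unfolding Let_def
  proof (intro conjI ballI impI, goal_cases)
    case 1
    then show ?case using asymptotic_normality[OF v] by (simp add: delta_def)
  next
    case (2 p)
    then show ?case using asymptotic_normality_coordinate[OF v] by (simp add: delta_def)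
  next
    case (3 p)
    then show ?case by (rule unit_quadratic_form[OF finite, symmetric])
  next
    case (4 a b)
    then show ?case by (rule R_cross_moments[OF v])
  next
    case (5 a b)
    then show ?case by (blast intro: R_cross_moments[OF v])
  next
    case (6 a b)
    then show ?case by (blast intro: R_cross_moments[OF v])
  next
    case (7 a b)
    then show ?case by (blast intro: R_cross_moments[OF v])
  qed
qed

end
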